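(* Let $\alpha\in(0,1)$ be an irrational number of bounded type, $\beta=2\alpha-1$, and let $\phi^t:\mathsf{St}\to\mathsf{St}$ be the linear flow on the infinite staircase with velocity $\binom\beta1$. Let $\sigma_T>0$ and $a_T(\tilde\omega)\in\mathbb R$ be normalizing functions of the temporal central limit theorem for $\phi$, i.e. satisfying: (1) for every $\tilde\omega\in\mathsf{St}$ and all $a<b$, $\lim_{T\to\infty}\frac1T\mathrm{mes}\{t\in[0,T]:\frac{\mathfrak z(\phi^t\tilde\omega)-a_T(\tilde\omega)}{\sigma_T}\in[a,b]\}=\frac1{\sqrt{2\pi}}\int_a^be^{-s^2/2}ds$; (2) for some $C$, for all $\tilde\omega$ and all $T>C$, $|a_T(\tilde\omega)|\le C\log T$ and $C^{-1}\le\sigma_T/\sqrt{\log T}\le C$; (3) for some $C$, for all $\tilde\omega$ and all $T>C$, there is $n=n(T)\in\mathbb N$ such that $C^{-1}<n/\log T<C$ and $a_T(\tilde\omega)=z_n(\tilde\omega)$. If $\tilde\omega\in\mathsf{St}$, $k_T\in\mathbb Z$, $s\in\mathbb R$ and $\frac{k_T-a_T(\tilde\omega)}{\sigma_T}\xrightarrow[T\to\infty]{}s$, then $$\frac1T\mathrm{mes}\{t\in[0,T]:\phi^t(\tilde\omega)\in\mathsf R_{k_T}\}=[1+o(1)]\frac{e^{-s^2/2}}{\sqrt{2\pi\sigma_T^2}}\quad\text{as }T\to\infty .$$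
   Context: $\mathrm{mes}$ is Lebesgue measure on $\mathbb R$. **Staircase.** For $k\in\mathbb Z$ let $\overline{\mathsf R}_k$ be a copy of $[0,2]\times[0,1]$, with points written $(x,y)_k$. The infinite staircase $\mathsf{St}$ is the quotient of $\bigsqcup_k\overline{\mathsf R}_k$ by the identifications $(0,y)_k\sim(2,y)_k$ ($0\le y\le1$), $(x,1)_k\sim(x-1,0)_{k+1}$ ($1\le x\le2$), $(x,1)_k\sim(x+1,0)_{k-1}$ ($0\le x\le1$), with the natural locally Euclidean metric. The points $(i,j)_k$, $i\in\{0,1,2\},j\in\{0,1\}$, represent exactly four points of $\mathsf{St}$, the singularities; $\mathsf{St}^*:=\mathsf{St}\setminus\{\text{singularities}\}$ is a translation surface and its tangent spaces are identified with $\mathbb R^2$. The horizontal rectangle $\mathsf R_k$ is the set of points of $\mathsf{St}^*$ having a representative $(x,y)_k$ with $0<y\le1$; the $\mathsf R_k$ partition $\mathsf{St}^*$. Put $\mathfrak z(p):=k$ if $p\in\mathsf R_k$. $D:\mathsf{St}\to\mathsf{St}$ is $(x,y)_k\mapsto(x,y)_{k+1}$. $\mu_0=\tfrac12\times$ area. **Flow.** $\phi^t$ ($t\ge0$) moves points at constant velocity $\binom\beta1$, subject to the identifications. A trajectory that starts at or hits a singularity emerges from the left-most congruent singularity on the sides of $\overline{\mathsf R}_0$ and continues upward in direction $\binom\beta1$ (concretely: into $\overline{\mathsf R}_0$ from $(0,0)_0$ or from $(1,0)_0$; from $(0,1)_0\sim(1,0)_{-1}$ into $\overline{\mathsf R}_{-1}$;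 from $(1,1)_0\sim(0,0)_1$ into $\overline{\mathsf R}_1$; rays from $(0,0)_k$ with $\beta<0$ are read modulo $(0,y)_k\sim(2,y)_k$); this happens at most once. **The functions $z_n$.** Bounded type means bounded regular continued fraction partial quotients. Let $\beta=[0;2m_1,2m_2,\ldots]$, $m_i\in\mathbb Z\setminus\{0\}$, be the (unique) even continued fraction expansion of $\beta\in(-1,1)$. Define $\binom{p_{-1}}{q_{-1}}=\binom10$, $\binom{p_0}{q_0}=\binom01$, $p_k=2m_kp_{k-1}+p_{k-2}$, $q_k=2m_kq_{k-1}+q_{k-2}$, and $A_n(\beta):=\begin{pmatrix}p_{2n-1}&p_{2n}\\ q_{2n-1}&q_{2n}\end{pmatrix}^{-1}$, which lies in $\Gamma(2)=\{A\in SL(2,\mathbb Z):A\equiv \mathrm{Id}\bmod2\}$. A homogeneous automorphism is a homeomorphism $\tilde\psi$ of $\mathsf{St}$ with $\tilde\psi(\mathsf{St}^* )=\mathsf{St}^*$, differentiable on $\mathsf{St}^*$ with constant derivative matrix of positive determinant, commuting with $D$ and preserving the $D$-orbits of singularities; its drift is $\delta(\tilde\psi):=\int_{\mathsf R_0}[\mathfrak z(\tilde\psi(p))-\mathfrak z(p)]\,d\mu_0(p)$. For each $A\in\Gamma(2)$ there is a unique homogeneous automorphism with derivative $A$ and drift $0$; $\tilde\Psi_n$ denotes the one with derivative $A_n(\beta)$. For $\tilde\omega\in\mathsf{St}^*$, $z_n(\tilde\omega):=\mathfrak z(\tilde\Psi_n(\tilde\omega))$; for singular $\tilde\omega$, $z_n(\tilde\omega):=\mathfrak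 z(\tilde\Psi_n(\phi^t(\tilde\omega)))$ for small $t>0$. *)

theory Defs
  imports "HOL-Analysis.Analysis" "HOL-Library.Real_Mod" "HOL-Library.Landau_Symbols"
begin

text \<open>Complete quotients of the regular continued fraction; the partial quotients are their floors.\<close>
fun complete_quotient :: "real \<Rightarrow> nat \<Rightarrow> real" where
  "complete_quotient x 0 = x"
| "complete_quotient x (Suc n) = 1 / frac (complete_quotient x n)"

definition partial_quotient :: "real \<Rightarrow> nat \<Rightarrow> int" where
  "partial_quotient x n = \<lfloor>complete_quotient x n\<rfloor>"

definition bounded_type :: "real \<Rightarrow> bool" where
  "bounded_type x \<longleftrightarrow> (\<exists>M. \<forall>n\<ge>1. partial_quotient x n \<le> M)"

text \<open>The triple \<open>(k, x, y)\<close> encodes the point \<open>(x, y)\<close> of the \<open>k\<close>-th closed rectangle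
  \<open>[0,2] \<times> [0,1]\<close>.\<close>

definition in_rect :: "int \<times> real \<times> real \<Rightarrow> bool" where
  "in_rect r \<longleftrightarrow> (case r of (k, x, y) \<Rightarrow> 0 \<le> x \<and> x \<le> 2 \<and> 0 \<le> y \<and> y \<le> 1)"

inductive glue :: "int \<times> real \<times> real \<Rightarrow> int \<times> real \<times> real \<Rightarrow> bool" where
  side: "0 \<le> y \<Longrightarrow> y \<le> 1 \<Longrightarrow> glue (k, 0, y) (k, 2, y)"
| up: "1 \<le> x \<Longrightarrow> x \<le> 2 \<Longrightarrow> glue (k, x, 1) (k + 1, x - 1, 0)"
| down: "0 \<le> x \<Longrightarrow> x \<le> 1 \<Longrightarrow> glue (k, x, 1) (k - 1, x + 1, 0)"
| refl: "in_rect r \<Longrightarrow> glue r r"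
| sym: "glue r s \<Longrightarrow> glue s r"
| trans: "glue r s \<Longrightarrow> glue s t \<Longrightarrow> glue r t"

quotient_type stair = "int \<times> real \<times> real" / partial: glue
proof (rule part_equivpI)
  show "\<exists>r. glue r r"
    by (rule exI[of _ "(0, 0, 0)"]) (auto intro: glue.refl simp: in_rect_def)
  show "symp glue" by (auto intro: sympI glue.sym)
  show "transp glue" by (blast intro: transpI glue.trans)
qed

text \<open>\<open>pt k x y\<close> is meaningful only for \<open>(x, y)\<close> in \<open>[0,2] \<times> [0,1]\<close>.\<close>
definition pt :: "int \<Rightarrow> real \<Rightarrow> real \<Rightarrow> stair" where
  "pt k x y = abs_stair (k, x, y)"

definition represents :: "int \<Rightarrow> real \<Rightarrow> real \<Rightarrow> stair \<Rightarrow> bool" where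
  "represents k x y p \<longleftrightarrow> in_rect (k, x, y) \<and> pt k x y = p"

definition singularities :: "stair set" where
  "singularities = {pt k x y | k x y. x \<in> {0, 1, 2} \<and> y \<in> {0, 1}}"

definition regular_points :: "stair set" where
  "regular_points = UNIV - singularities"

definition horizontal_rect :: "int \<Rightarrow> stair set" where
  "horizontal_rect k = {p \<in> regular_points. \<exists>x y. represents k x y p \<and> 0 < y}"

text \<open>The value of \<open>level\<close> at the singularities is left unspecified.\<close>
definition level :: "stair \<Rightarrow> int" where
  "level p = (THE k. p \<in> horizontal_rect k)"

text \<open>\<open>shift j\<close> is the \<open>j\<close>-th power of the deck transformation \<open>D = shift 1\<close>.\<close>
lift_definition shift :: "int \<Rightarrow> stair \<Rightarrow> stair" is "\<lambda>j (k, x, y). (k + j, x, y)"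
proof -
  fix j :: int and r s :: "int \<times> real \<times> real"
  assume "glue r s"
  then show "glue (case r of (k, x, y) \<Rightarrow> (k + j, x, y)) (case s of (k, x, y) \<Rightarrow> (k + j, x, y))"
  proof (induction rule: glue.induct)
    case (side y k)
    then show ?case by (simp add: glue.side)
  next
    case (up x k)
    then show ?case using glue.up[of x "k + j"] by (simp add: algebra_simps)
  next
    case (down x k)
    then show ?case using glue.down[of x "k + j"] by (simp add: algebra_simps)
  next
    case (refl r)
    then show ?case by (auto intro: glue.refl simp: in_rect_def split: prod.splits)
  next
    case (sym r s)
    then show ?case by (blast intro: glue.sym)
  next
    case (trans r s t)
    then show ?case by (blast intro: glue.trans)
  qed
qed

definition deck_orbit :: "stair \<Rightarrow> stair set" where
  "deck_orbit p = range (\<lambda>j. shift j p)"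

text \<open>\<open>polyline p q l\<close>: a broken line of length \<open>l\<close> joins \<open>p\<close> to \<open>q\<close>, each of its pieces being a
  straight segment inside one closed rectangle.\<close>
inductive polyline :: "stair \<Rightarrow> stair \<Rightarrow> real \<Rightarrow> bool" where
  "polyline p p 0"
| "polyline p q l \<Longrightarrow> represents k x y q \<Longrightarrow> represents k x' y' r \<Longrightarrow>
     polyline p r (l + dist (x, y) (x', y'))"

definition stair_dist :: "stair \<Rightarrow> stair \<Rightarrow> real" where
  "stair_dist p q = Inf {l. polyline p q l}"

text \<open>This is the metric topology. At the singularities, where infinitely many rectangles meet, it is
  strictly coarser than the quotient topology.\<close>
definition stair_topology :: "stair topology" where
  "stair_topology = Metric_space.mtopology UNIV stair_dist"

text \<open>\<open>displaced p v q\<close>: some closed rectangle contains a straight segment from \<open>p\<close> to \<open>q\<close> with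
  displacement vector \<open>v\<close>. For a regular point \<open>p\<close> this describes, for small \<open>v\<close>, the translation
  chart centred at \<open>p\<close>.\<close>
definition displaced :: "stair \<Rightarrow> real ^ 2 \<Rightarrow> stair \<Rightarrow> bool" where
  "displaced p v q \<longleftrightarrow> (\<exists>k x y. represents k x y p \<and> represents k (x + v $ 1) (y + v $ 2) q)"

text \<open>In the translation charts at \<open>p\<close> and \<open>f p\<close>, the map \<open>f\<close> is a function \<open>g\<close> with \<open>g 0 = 0\<close> which
  is differentiable at \<open>0\<close> with derivative \<open>A\<close>.\<close>
definition has_stair_derivative :: "(stair \<Rightarrow> stair) \<Rightarrow> real ^ 2 ^ 2 \<Rightarrow> stair \<Rightarrow> bool" where
  "has_stair_derivative f A p \<longleftrightarrow>
     (\<exists>g. g 0 = 0 \<and> (g has_derivative (\<lambda>v. A *v v)) (at 0) \<and>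
        (\<forall>\<^sub>F v in nhds 0. \<forall>q. displaced p v q \<longrightarrow> displaced (f p) (g v) (f q)))"

definition homogeneous_automorphism :: "(stair \<Rightarrow> stair) \<Rightarrow> real ^ 2 ^ 2 \<Rightarrow> bool" where
  "homogeneous_automorphism f A \<longleftrightarrow>
     homeomorphic_map stair_topology stair_topology f \<and>
     f ` regular_points = regular_points \<and>
     (\<forall>p\<in>regular_points. has_stair_derivative f A p) \<and> det A > 0 \<and>
     (\<forall>p. f (shift 1 p) = shift 1 (f p)) \<and>
     (\<forall>p\<in>singularities. f ` deck_orbit p = deck_orbit p)"

text \<open>The measure \<open>\<mu>\<^sub>0\<close> on the zeroth rectangle is half the Lebesgue measure in its coordinates; the
  edge \<open>x = 0\<close>, which is identified with \<open>x = 2\<close>, is a null set.\<close>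
definition drift :: "(stair \<Rightarrow> stair) \<Rightarrow> real" where
  "drift f = 1 / 2 * (LINT (x, y) : {0..2} \<times> {0<..1} | lborel.
     real_of_int (level (f (pt 0 x y)) - level (pt 0 x y)))"

text \<open>The representative from which the trajectory of \<open>p\<close> leaves, upwards. At a singularity it is the
  prescribed continuation: from \<open>(0,0)\<close> or \<open>(1,0)\<close> into rectangle \<open>0\<close>, from
  \<open>(0,1)\<^sub>0 \<sim> (1,0)\<^sub>-\<^sub>1\<close> into rectangle \<open>-1\<close>, and from \<open>(1,1)\<^sub>0 \<sim> (0,0)\<^sub>1\<close> into rectangle \<open>1\<close>.\<close>
definition departure :: "stair \<Rightarrow> int \<times> real \<times> real" where
  "departure p =
     (if p \<in> singularities
      then THE r. r \<in> {(0, 0, 0), (0, 1, 0), (-1, 1, 0), (1, 0, 0)} \<and> abs_stair r = p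
      else THE r. (case r of (k, x, y) \<Rightarrow> 0 \<le> x \<and> x < 2 \<and> 0 \<le> y \<and> y < 1 \<and> pt k x y = p))"

text \<open>\<open>time_to_top p\<close> is the time the trajectory of \<open>p\<close> spends in its first closed rectangle, and
  \<open>rise\<close> is the motion during that time.\<close>
definition time_to_top :: "stair \<Rightarrow> real" where
  "time_to_top p = (case departure p of (k, x, y) \<Rightarrow> 1 - y)"

definition rise :: "real \<Rightarrow> real \<Rightarrow> stair \<Rightarrow> stair" where
  "rise \<beta> t p = (case departure p of (k, x, y) \<Rightarrow> pt k ((x + \<beta> * t) rmod 2) (y + t))"

text \<open>The flow with velocity \<open>(\<beta>, 1)\<close>, for \<open>t \<ge> 0\<close>. Having reached the top of its first
  rectangle, a trajectory sits on a lower edge of the next one, which it crosses in unit time, and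
  so on. Each application of \<open>rise\<close> selects the departing representative anew, so that
  singularities are also treated correctly when they are hit.\<close>
definition stair_flow :: "real \<Rightarrow> real \<Rightarrow> stair \<Rightarrow> stair" where
  "stair_flow \<beta> t p =
     (let h = time_to_top p in
      if t \<le> h then rise \<beta> t p
      else rise \<beta> (frac (t - h)) ((rise \<beta> 1 ^^ nat \<lfloor>t - h\<rfloor>) (rise \<beta> h p)))"

text \<open>Indices are shifted: \<open>m i\<close> stands for \<open>m\<^sub>i\<^sub>+\<^sub>1\<close>, and \<open>ecf_p m j\<close>, \<open>ecf_q m j\<close> stand for
  \<open>p\<^sub>j\<^sub>-\<^sub>1\<close>, \<open>q\<^sub>j\<^sub>-\<^sub>1\<close>.\<close>

fun ecf_p :: "(nat \<Rightarrow> int) \<Rightarrow> nat \<Rightarrow> int" where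
  "ecf_p m 0 = 1"
| "ecf_p m (Suc 0) = 0"
| "ecf_p m (Suc (Suc k)) = 2 * m k * ecf_p m (Suc k) + ecf_p m k"

fun ecf_q :: "(nat \<Rightarrow> int) \<Rightarrow> nat \<Rightarrow> int" where
  "ecf_q m 0 = 0"
| "ecf_q m (Suc 0) = 1"
| "ecf_q m (Suc (Suc k)) = 2 * m k * ecf_q m (Suc k) + ecf_q m k"

text \<open>The digits of the infinite expansion \<open>\<beta> = [0; 2m\<^sub>1, 2m\<^sub>2, \<dots>]\<close>.\<close>
definition even_cf :: "real \<Rightarrow> nat \<Rightarrow> int" where
  "even_cf \<beta> = (THE m. (\<forall>i. m i \<noteq> 0) \<and>
     (\<lambda>k. real_of_int (ecf_p m k) / real_of_int (ecf_q m k)) \<longlonglongrightarrow> \<beta>)"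

definition renorm_matrix :: "real \<Rightarrow> nat \<Rightarrow> real ^ 2 ^ 2" where
  "renorm_matrix \<beta> n = (let m = even_cf \<beta> in matrix_inv (vector
     [vector [real_of_int (ecf_p m (2 * n)), real_of_int (ecf_p m (2 * n + 1))],
      vector [real_of_int (ecf_q m (2 * n)), real_of_int (ecf_q m (2 * n + 1))]]))"

definition renorm_automorphism :: "real \<Rightarrow> nat \<Rightarrow> stair \<Rightarrow> stair" where
  "renorm_automorphism \<beta> n =
     (THE f. homogeneous_automorphism f (renorm_matrix \<beta> n) \<and> drift f = 0)"

definition renorm_level :: "real \<Rightarrow> nat \<Rightarrow> stair \<Rightarrow> int" where
  "renorm_level \<beta> n p =
     (if p \<in> regular_points then level (renorm_automorphism \<beta> n p)
      else THE j. \<forall>\<^sub>F t in at_right 0. level (renorm_automorphism \<beta> n (stair_flow \<beta> t p)) = j)"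

end

theory Submission
  imports Defs "HOL-Probability.Probability" "HOL-Number_Theory.Cong"
begin

text \<open>The flow crosses one rectangle per unit of time, and on top of each rectangle it moves up or down by one
  level according to the half of the edge that it hits. Modulo \<open>2\<close>, the horizontal coordinate performs a
  rotation by \<open>\<gamma> = 2 \<alpha>\<close>. Apart from a finite initial time (a trajectory meets a singularity at most once),
  the level is therefore a deterministic walk \<open>walk \<gamma> X n\<close>, a sum of signs read along the orbit of an
  irrational rotation; see \<open>flow_follows_walk\<close>.

  A central limit theorem says that the distribution of the level at a random time of \<open>[0, T]\<close> is Gaussian
  at the scale \<open>\<sigma> T\<close>; the theorem says that this remains true for single levels. As usual, the passage
  from one to the other is a matter of the characteristic function
  \<open>\<phi> T \<theta> = 1/T \<integral>\<^sub>0\<^sup>T exp (i \<theta> level) dt\<close>. Near \<open>\<theta> = 0\<close>, at the scale \<open>1 / \<sigma> T\<close>, it is controlled by the central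
  limit theorem. What is needed in addition is that it is small for all other \<open>\<bar>\<theta>\<bar> \<le> pi\<close>, and this is
  provided by \<open>\<bar>\<phi> T \<theta>\<bar> \<le> B T powr (- \<epsilon> \<theta>\<^sup>2)\<close>. As \<open>(\<sigma> T)\<^sup>2\<close> is of order \<open>ln T\<close>, the right-hand side is a
  Gaussian in \<open>u = \<theta> \<sigma> T\<close>, and dominated convergence in the inversion formula gives the result
  (\<open>temporal_local_limit\<close>).

  The estimate of \<open>\<phi>\<close> (\<open>walk_exp_sum_decay\<close>) rests on a self-similarity of the walk. For \<open>\<alpha>\<close> of bounded type,
  every stretch of length \<open>L\<close> contains two occurrences of the same word of length at least \<open>\<kappa> L\<close>, at levels
  that differ by exactly one (\<open>repeated_word\<close>). Their contributions to an exponential sum have the ratio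
  \<open>exp (\<plusminus>i \<theta>)\<close>, so that a fraction of order \<open>\<kappa> \<theta>\<^sup>2\<close> of the sum cancels, at every scale. There are about
  \<open>ln T\<close> scales below \<open>T\<close>, which explains the power of \<open>T\<close>.\<close>

section \<open>Numbers of bounded type\<close>

definition badly_approximable :: "real \<Rightarrow> real \<Rightarrow> bool" where
  "badly_approximable c x \<longleftrightarrow>
     0 < c \<and> (\<forall>n p. 1 \<le> n \<longrightarrow> c / real n \<le> \<bar>real n * x - real_of_int p\<bar>)"

lemma complete_quotient_step: "complete_quotient (1 / frac x) n = complete_quotient x (Suc n)"
  by (induction n) auto

lemma frac_pos_irrational: "x \<notin> \<rat> \<Longrightarrow> 0 < frac x"
  by (metis Ints_subset_Rats frac_gt_0_iff subsetD)

lemma inverse_frac_irrational: "x \<notin> \<rat> \<Longrightarrow> 1 / frac x \<notin> \<rat>"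
proof
  assume x: "x \<notin> \<rat>" "1 / frac x \<in> \<rat>"
  then have "frac x \<in> \<rat>"
    using Rats_divide[of 1 "1 / frac x"] by simp
  then have "frac x + of_int \<lfloor>x\<rfloor> \<in> \<rat>" by (intro Rats_add) auto
  then show False using x by (simp add: frac_def)
qed

lemma frac_bounds_of_partial_quotients:
  fixes M :: int
  assumes irr: "x \<notin> \<rat>" and le: "\<forall>n\<ge>1. partial_quotient x n \<le> M"
  shows "0 < M" "1 / (of_int M + 1) \<le> frac x" "1 / (of_int M + 1)\<^sup>2 \<le> 1 - frac x"
proof -
  define y where "y = 1 / frac x"
  have fx: "0 < frac x" "frac x < 1" using frac_pos_irrational[OF irr] frac_lt_1 by auto
  have y: "1 < y" using fx by (simp add: y_def)
  have irr': "y \<notin> \<rat>" using inverse_frac_irrational[OF irr] by (simp add: y_def)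
  have fy: "0 < frac y" using frac_pos_irrational[OF irr'] .
  have ym: "\<lfloor>y\<rfloor> \<le> M"
    using le[rule_format, of 1] by (simp add: partial_quotient_def y_def)
  have fm: "\<lfloor>1 / frac y\<rfloor> \<le> M"
    using le[rule_format, of 2] by (simp add: partial_quotient_def y_def numeral_2_eq_2)
  have "1 \<le> \<lfloor>y\<rfloor>" using y by linarith
  then show M: "0 < M" using ym by linarith
  have y2: "y \<le> of_int M + 1" using ym by linarith
  have "1 / frac y \<le> of_int M + 1" using fm by linarith
  then have fy2: "1 / (of_int M + 1) \<le> frac y" using fy M by (simp add: field_simps)
  show "1 / (of_int M + 1) \<le> frac x" using y2 fx M by (simp add: field_simps y_def)
  have "1 + frac y \<le> y" using \<open>1 \<le> \<lfloor>y\<rfloor>\<close> by (simp add: frac_def)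
  then have y1: "1 / (of_int M + 1) \<le> y - 1" using fy2 by linarith
  have "1 / (of_int M + 1 :: real)\<^sup>2 = (1 / (of_int M + 1)) / (of_int M + 1)"
    by (simp add: power2_eq_square)
  also have "\<dots> \<le> (y - 1) / y"
    using y1 y2 y M by (intro frac_le) auto
  also have "\<dots> = 1 - frac x" using fx by (simp add: y_def field_simps)
  finally show "1 / (of_int M + 1)\<^sup>2 \<le> 1 - frac x" .
qed

text \<open>Writing \<open>\<bar>q x - p\<bar> = x \<bar>p y - q\<bar>\<close> with \<open>y = 1 / x\<close> turns an approximation of \<open>x\<close> with denominator
  \<open>q\<close> into one of \<open>y\<close> with the smaller denominator \<open>p\<close>, and \<open>y\<close> has the same partial quotients, shifted.
  If \<open>p > q x\<close>, a plain bound \<open>d / q\<close> would lose a factor at each descent. The bound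
  \<open>d / (q - 1/2)\<close> is exactly inherited: \<open>x (q - 1/2) \<ge> p - 1/2\<close> holds unless
  \<open>p - q x > (1 - x) / 2\<close>, and in that case \<open>p\<close> is a poor approximation anyway.\<close>
lemma approximation_lower_bound:
  fixes M :: int and p :: int
  assumes "x \<notin> \<rat>" "\<forall>n\<ge>1. partial_quotient x n \<le> M" "1 \<le> q"
  shows "1 / (4 * (of_int M + 1)\<^sup>2) / (real q - 1 / 2) \<le> \<bar>real q * x - of_int p\<bar>"
  using assms
proof (induction q arbitrary: x p rule: less_induct)
  case (less q)
  define d where "d = 1 / (of_int M + 1 :: real)\<^sup>2"
  define f where "f = frac x"
  define r where "r = p - int q * \<lfloor>x\<rfloor>"
  note b = frac_bounds_of_partial_quotients[OF less.prems(1,2), folded f_def d_def]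
  have f: "0 < f" "f < 1" using frac_pos_irrational[OF less.prems(1)] frac_lt_1 by (auto simp: f_def)
  have d: "0 < d" using b(1) by (simp add: d_def)
  have "(of_int M + 1)\<^sup>2 \<ge> (of_int M + 1 :: real)"
    using b(1) by (intro self_le_power) auto
  then have "d \<le> 1 / (of_int M + 1)"
    using b(1) unfolding d_def by (intro divide_left_mono) auto
  then have df: "d \<le> f" using b(2) by linarith
  have q: "real q \<ge> 1" using less.prems(3) by simp
  have eq: "real q * x - of_int p = real q * f - of_int r"
    by (simp add: f_def r_def frac_def algebra_simps)
  have quarter: "d / 4 / (real q - 1 / 2) \<le> d / 2"
    using q d by (simp add: field_simps)
  have "d / 4 / (real q - 1 / 2) \<le> \<bar>real q * f - of_int r\<bar>"
  proof -
    consider "r \<le> 0" | "int q \<le> r" | "0 < r" "r < int q" by linarith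
    then show ?thesis
    proof cases
      case 1
      have "f \<le> real q * f" using q f by simp
      moreover have "real_of_int r \<le> 0" using 1 by simp
      ultimately show ?thesis using quarter df d by linarith
    next
      case 2
      have "real q * f + (1 - f) \<le> real q"
        using mult_right_mono[of 1 "real q" "1 - f"] q f by (simp add: algebra_simps)
      moreover have "real q \<le> of_int r" using 2 by linarith
      ultimately have "1 - f \<le> \<bar>real q * f - of_int r\<bar>" by linarith
      then show ?thesis using quarter b(3) d by linarith
    next
      case 3
      define y where "y = 1 / f"
      define r' where "r' = nat r"
      have r': "real_of_int r = real r'" "1 \<le> r'" "r' < q" using 3 by (auto simp: r'_def)
      have irr': "y \<notin> \<rat>" using inverse_frac_irrational[OF less.prems(1)] by (simp add: y_def f_def)
      have le': "\<forall>n\<ge>1. partial_quotient y n \<le> M"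
        using less.prems(2)
        unfolding partial_quotient_def y_def f_def complete_quotient_step by (metis le_SucI)
      have IH: "d / 4 / (real r' - 1 / 2) \<le> \<bar>real r' * y - of_int (int q)\<bar>"
        using less.IH[OF r'(3) irr' le' r'(2), of "int q"] by (simp add: d_def mult.commute)
      have flip: "\<bar>real q * f - of_int r\<bar> = f * \<bar>real r' * y - of_int (int q)\<bar>"
      proof -
        have "real q * f - of_int r = - f * (real r' * y - of_int (int q))"
          using f by (simp add: y_def r' algebra_simps)
        then show ?thesis using f by (simp add: abs_mult)
      qed
      show ?thesis
      proof (cases "real r' - real q * f \<le> (1 - f) / 2")
        case True
        then have *: "real r' - 1 / 2 \<le> f * (real q - 1 / 2)" by (simp add: field_simps)
        have "d / 4 / (real q - 1 / 2) = f * (d / 4) / (f * (real q - 1 / 2))"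
          using f by simp
        also have "\<dots> \<le> f * (d / 4) / (real r' - 1 / 2)"
          using * r' f d q by (intro divide_left_mono mult_pos_pos) auto
        also have "\<dots> \<le> f * \<bar>real r' * y - of_int (int q)\<bar>"
          using mult_left_mono[OF IH, of f] f by simp
        finally show ?thesis by (simp add: flip)
      next
        case False
        have "real r' - real q * f \<le> \<bar>real q * f - of_int r\<bar>" unfolding r'(1) by simp
        then have "d / 2 \<le> \<bar>real q * f - of_int r\<bar>" using False b(3) by argo
        then show ?thesis using quarter by linarith
      qed
    qed
  qed
  then show ?case unfolding eq d_def by (simp add: mult.commute)
qed

lemma bounded_type_imp_badly_approximable:
  assumes "x \<notin> \<rat>" "bounded_type x"
  shows "\<exists>c. badly_approximable c x"
proof -
  from assms(2) obtain M where M: "\<forall>n\<ge>1. partial_quotient x n \<le> M"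
    by (auto simp: bounded_type_def)
  define c where "c = 1 / (4 * (of_int M + 1 :: real)\<^sup>2)"
  have c: "0 < c" using frac_bounds_of_partial_quotients(1)[OF assms(1) M] by (simp add: c_def)
  have "c / real n \<le> \<bar>real n * x - real_of_int p\<bar>" if n: "1 \<le> n" for n p
  proof -
    have "c / real n \<le> c / (real n - 1 / 2)" using c n by (intro divide_left_mono) auto
    also have "\<dots> \<le> \<bar>real n * x - real_of_int p\<bar>"
      unfolding c_def by (rule approximation_lower_bound[OF assms(1) M n])
    finally show ?thesis .
  qed
  then show ?thesis using c by (auto simp: badly_approximable_def)
qed

lemma badly_approximable_double:
  assumes "badly_approximable c x"
  shows "badly_approximable (c / 2) (2 * x)"
  unfolding badly_approximable_def
proof (intro conjI allI impI)
  show "0 < c / 2" using assms by (simp add: badly_approximable_def)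
  fix n :: nat and p :: int
  assume "1 \<le> n"
  then have "c / real (2 * n) \<le> \<bar>real (2 * n) * x - p\<bar>"
    using assms unfolding badly_approximable_def by (metis mult_2 trans_le_add1)
  then show "c / 2 / real n \<le> \<bar>real n * (2 * x) - p\<bar>" by (simp add: algebra_simps)
qed

text \<open>Dirichlet's theorem gives a fraction \<open>h / k\<close> with \<open>k \<le> N\<close> such that the first \<open>k\<close> multiples of \<open>a\<close> are
  within \<open>1 / k\<close> of the corresponding multiples of \<open>h / k\<close>, which modulo \<open>1\<close> exhaust the grid of mesh
  \<open>1 / k\<close>. Bad approximability forces \<open>k \<ge> c N\<close>, so that this mesh is of order \<open>1 / N\<close>.\<close>
lemma orbit_near_every_point:
  fixes x y a :: real and N :: nat
  assumes bad: "badly_approximable c a" and N: "0 < N"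
  obtains n z where "n < N" "\<bar>x + real n * a - y - real_of_int z\<bar> \<le> 2 / (c * real N)"
proof -
  obtain h k where hk: "coprime h k" "0 < k" "k \<le> int N" "\<bar>of_int k * a - of_int h\<bar> < 1 / real N"
    using Dirichlet_approx_coprime[OF N] by metis
  define q where "q = nat k"
  have q: "of_int k = real q" "0 < q" "q \<le> N" using hk by (auto simp: q_def)
  have c: "0 < c" using bad by (simp add: badly_approximable_def)
  have "c / real q \<le> \<bar>real q * a - of_int h\<bar>"
    using bad q unfolding badly_approximable_def by simp
  then have "c / real q \<le> 1 / real N" using hk(4) q by simp
  then have cN: "c * real N \<le> real q" using q N by (simp add: field_simps)
  \<comment> \<open>the grid point \<open>r / q\<close> is the target; \<open>n\<close> solves \<open>h n = r\<close> modulo \<open>q\<close>\<close>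
  define r where "r = \<lfloor>real q * (y - x)\<rfloor>"
  obtain u where u: "[h * u = 1] (mod k)"
    using cong_solve_coprime_int[OF hk(1)] by blast
  define n where "n = nat ((u * r) mod k)"
  have n: "int n = (u * r) mod k" using hk by (simp add: n_def)
  have "[h * int n = h * (u * r)] (mod k)"
    unfolding n by (intro cong_scalar_left) simp
  also have "[h * (u * r) = r] (mod k)"
    using cong_scalar_right[OF u, of r] by (simp add: ac_simps)
  finally obtain w where w: "h * int n = r + k * w"
    by (metis cong_iff_lin cong_sym)
  have nq: "n < q" using n hk by (simp add: q_def n_def nat_mono_iff)
  have hr: "real n * of_int h = of_int r + real q * of_int w"
    using w q by (metis mult.commute of_int_add of_int_mult of_int_of_nat_eq)
  have split: "x + real n * a - y - of_int w =
      (of_int r - real q * (y - x)) / real q + real n * (real q * a - of_int h) / real q"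
    using q hr by (simp add: field_simps)
  have "\<bar>of_int r - real q * (y - x)\<bar> \<le> 1" unfolding r_def by linarith
  then have 1: "\<bar>(of_int r - real q * (y - x)) / real q\<bar> \<le> 1 / real q"
    using q by (simp add: divide_right_mono)
  have "\<bar>real n * (real q * a - of_int h)\<bar> \<le> real N * (1 / real N)"
    unfolding abs_mult using hk(4) q nq by (intro mult_mono) auto
  then have 2: "\<bar>real n * (real q * a - of_int h) / real q\<bar> \<le> 1 / real q"
    using q N by (simp add: divide_right_mono)
  have "\<bar>x + real n * a - y - of_int w\<bar> \<le> 2 / real q"
    unfolding split
    using abs_triangle_ineq[of "(of_int r - real q * (y - x)) / real q"
        "real n * (real q * a - of_int h) / real q"] 1 2 by simp
  also have "\<dots> \<le> 2 / (c * real N)"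
    using cN c N by (intro divide_left_mono) (auto simp: q)
  finally show ?thesis using that[of n w] nq q by simp
qed

section \<open>The walk driven by a rotation\<close>

text \<open>On the circle of length \<open>2\<close>, the direction in which a trajectory that reaches the top of a rectangle
  changes its level: down over the left half, up over the right half.\<close>
definition step :: "real \<Rightarrow> int" where
  "step x = (if even \<lfloor>x\<rfloor> then - 1 else 1)"

text \<open>Crossing one rectangle moves the horizontal coordinate by \<open>\<beta>\<close>, and the identification of the top moves
  it by \<open>\<plusminus>1\<close>; modulo \<open>2\<close> this is the rotation by \<open>\<gamma> = \<beta> + 1\<close>.\<close>
definition walk :: "real \<Rightarrow> real \<Rightarrow> nat \<Rightarrow> int" where
  "walk \<gamma> x n = (\<Sum>i<n. step (x + real i * \<gamma>))"

lemma step_add_even [simp]: "step (x + 2 * of_int z) = step x"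
proof -
  have "x + 2 * of_int z = x + of_int (2 * z)" by simp
  then show ?thesis unfolding step_def by (metis dvd_triv_left even_add floor_add_int)
qed

lemma step_add_one: "step (x + 1) = - step x"
  by (simp add: step_def)

lemma step_differs_near_integer:
  assumes "step x \<noteq> step y" "\<bar>x - y - 2 * of_int z\<bar> \<le> \<delta>"
  shows "\<exists>w::int. \<bar>x - of_int w\<bar> \<le> \<delta>"
proof -
  define y' where "y' = y + 2 * of_int z"
  have "step x \<noteq> step y'" using assms by (simp add: y'_def)
  then have "\<lfloor>x\<rfloor> \<noteq> \<lfloor>y'\<rfloor>" by (auto simp: step_def)
  then consider "\<lfloor>x\<rfloor> < \<lfloor>y'\<rfloor>" | "\<lfloor>y'\<rfloor> < \<lfloor>x\<rfloor>" by linarith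
  then show ?thesis
  proof cases
    case 1
    then have "x \<le> \<lfloor>y'\<rfloor>" "\<lfloor>y'\<rfloor> \<le> y'" by linarith+
    then have "\<bar>x - \<lfloor>y'\<rfloor>\<bar> \<le> \<bar>x - y'\<bar>" by linarith
    then show ?thesis using assms(2) unfolding y'_def by (metis diff_diff_add order.trans)
  next
    case 2
    then have "y' \<le> \<lfloor>x\<rfloor>" "\<lfloor>x\<rfloor> \<le> x" by linarith+
    then have "\<bar>x - \<lfloor>x\<rfloor>\<bar> \<le> \<bar>x - y'\<bar>" by linarith
    then show ?thesis using assms(2) unfolding y'_def by (metis diff_diff_add order.trans)
  qed
qed

lemma walk_0 [simp]: "walk \<gamma> x 0 = 0"
  by (simp add: walk_def)

lemma walk_Suc: "walk \<gamma> x (Suc n) = walk \<gamma> x n + step (x + real n * \<gamma>)"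
  by (simp add: walk_def)

lemma walk_add: "walk \<gamma> x (a + b) = walk \<gamma> x a + walk \<gamma> (x + real a * \<gamma>) b"
  by (induction b) (auto simp: walk_Suc algebra_simps)

lemma even_walk_iff: "even (walk \<gamma> x n) \<longleftrightarrow> even n"
  by (induction n) (auto simp: walk_Suc step_def)

text \<open>Increments over \<open>m\<close> consecutive steps stay the same along a stretch of starting times exactly when
  the word of steps read along that stretch is repeated \<open>m\<close> steps later.\<close>
lemma walk_shift_difference:
  "walk \<gamma> (x + real (Suc n) * \<gamma>) m - walk \<gamma> (x + real n * \<gamma>) m =
     step (x + real (n + m) * \<gamma>) - step (x + real n * \<gamma>)"
proof -
  have "walk \<gamma> x (n + m) + step (x + real (n + m) * \<gamma>) = walk \<gamma> x (Suc n + m)"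
    by (simp add: walk_Suc)
  then show ?thesis unfolding walk_add[of \<gamma> x "Suc n"] walk_add[of \<gamma> x n] walk_Suc
    by linarith
qed

text \<open>The steps of nearby orbits can differ only when the orbit is close to an integer, and an orbit of a badly
  approximable rotation returns close to the integers only after a long time.\<close>
lemma close_integers_far_in_time:
  assumes bad: "badly_approximable c \<gamma>" and "i < j"
    and "\<bar>x + real i * \<gamma> - of_int u\<bar> \<le> \<delta>" "\<bar>x + real j * \<gamma> - of_int v\<bar> \<le> \<delta>"
  shows "c \<le> 2 * \<delta> * real (j - i)"
proof -
  have "c / real (j - i) \<le> \<bar>real (j - i) * \<gamma> - of_int (v - u)\<bar>"
    using bad assms(2) unfolding badly_approximable_def by (metis One_nat_def Suc_leI zero_less_diff)
  also have "\<dots> \<le> 2 * \<delta>"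
    using assms(2-4) by (simp add: of_nat_diff algebra_simps)
  finally show ?thesis using assms(2) by (simp add: field_simps)
qed

text \<open>Moving a starting point by \<open>1\<close> reverses all steps. A point \<open>y\<close> close to \<open>x + 1\<close> therefore has the
  reversed walk, up to steps made near an integer, and there is at most one such time before \<open>m\<close>.\<close>
lemma walk_antisymmetry:
  assumes bad: "badly_approximable c \<gamma>" and close: "\<bar>y - (x + 1) - 2 * of_int z\<bar> \<le> \<delta>"
    and small: "2 * \<delta> * real m < c"
  shows "\<bar>walk \<gamma> y m + walk \<gamma> x m\<bar> \<le> 2"
proof -
  define J where "J = {i. i < m \<and> step (y + real i * \<gamma>) \<noteq> step (x + 1 + real i * \<gamma>)}"
  have fin: "finite J" by (simp add: J_def)
  have near: "\<exists>w::int. \<bar>y + real i * \<gamma> - of_int w\<bar> \<le> \<delta>" if "i \<in> J" for i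
    using that close
    by (intro step_differs_near_integer[of _ "x + 1 + real i * \<gamma>" z]) (auto simp: J_def)
  have d: "0 \<le> \<delta>" using close by linarith
  have no: "\<not> i < j" if "i \<in> J" "j \<in> J" for i j
  proof
    assume "i < j"
    have "c \<le> 2 * \<delta> * real (j - i)"
      using near[OF that(1)] near[OF that(2)] close_integers_far_in_time[OF bad \<open>i < j\<close>] by blast
    also have "\<dots> \<le> 2 * \<delta> * real m" using that d by (intro mult_left_mono) (auto simp: J_def)
    finally show False using small by simp
  qed
  then have "card J \<le> 1"
    by (metis One_nat_def card_le_Suc0_iff_eq fin linorder_neqE_nat)
  have "walk \<gamma> y m + walk \<gamma> x m = (\<Sum>i<m. step (y + real i * \<gamma>) - step (x + 1 + real i * \<gamma>))"
    using step_add_one[of "x + real i * \<gamma>" for i]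
    by (simp add: walk_def sum.distrib[symmetric] algebra_simps)
  also have "\<dots> = (\<Sum>i\<in>J. step (y + real i * \<gamma>) - step (x + 1 + real i * \<gamma>))"
    by (rule sum.mono_neutral_right) (auto simp: J_def)
  also have "\<bar>\<dots>\<bar> \<le> (\<Sum>i\<in>J. 2)"
    by (rule order.trans[OF sum_abs sum_mono]) (auto simp: step_def)
  also have "\<dots> \<le> 2" using \<open>card J \<le> 1\<close> by simp
  finally show ?thesis .
qed

lemma discrete_intermediate_value:
  fixes v :: "nat \<Rightarrow> int"
  assumes odd: "\<And>n. odd (v n)" and step: "\<And>n. \<bar>v (Suc n) - v n\<bar> \<le> 2"
    and anti: "\<bar>v k + v 0\<bar> \<le> 2"
  shows "\<exists>n\<le>k. \<bar>v n\<bar> = 1"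
proof (rule ccontr)
  assume no: "\<not> ?thesis"
  have far: "3 \<le> \<bar>v n\<bar>" if "n \<le> k" for n
  proof -
    have "\<bar>v n\<bar> \<noteq> 1" using no that by blast
    moreover have "v n \<noteq> 0" "v n \<noteq> 2" "v n \<noteq> - 2" using odd[of n] by auto
    ultimately show ?thesis by linarith
  qed
  have "(0 < v n) = (0 < v 0)" if "n \<le> k" for n
    using that
  proof (induction n)
    case (Suc n)
    then show ?case using far[of n] far[of "Suc n"] step[of n] by simp linarith
  qed simp
  from this[of k] show False using far[of 0] far[of k] anti by simp linarith
qed

text \<open>The source of the cancellation. Every stretch of length \<open>L\<close> contains a word of length \<open>h\<close>, a fixed
  fraction of \<open>L\<close>, that occurs twice, at levels that differ by exactly one.

  The distance \<open>m\<close> of the two occurrences is an odd number comparable with \<open>L\<close> such that \<open>m \<gamma>\<close> is within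
  \<open>O(1 / L)\<close> of \<open>2\<int>\<close>; it comes from a multiple of \<open>2 \<alpha>\<close> that is close to \<open>- \<alpha>\<close> modulo \<open>1\<close>. The
  increments \<open>v n\<close> of the walk over \<open>m\<close> steps are odd numbers, and \<open>v\<close> changes by at most \<open>2\<close> at a time, at
  instants (\<open>jump\<close>) that are separated by at least \<open>2 h\<close>. For some \<open>k = O(L)\<close> the orbit comes so close to
  the point opposite to its start that \<open>v k\<close> is \<open>- v 0\<close> up to \<open>2\<close>; in between, \<open>v\<close> must take one of the
  values \<open>\<plusminus>1\<close>. As jumps are rare, it keeps this value during \<open>h\<close> steps before or after that instant.\<close>
lemma repeated_word:
  assumes bad: "badly_approximable c \<alpha>"
  defines "\<gamma> \<equiv> 2 * \<alpha>"
  shows "\<exists>\<kappa> L0. 0 < \<kappa> \<and> (\<forall>L\<ge>L0. \<forall>x. \<exists>n m h. \<kappa> * real L \<le> real h \<and> h \<le> m \<and> n + m + h \<le> L \<and>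
    \<bar>walk \<gamma> (x + real n * \<gamma>) m\<bar> = 1 \<and>
    (\<forall>i\<le>h. walk \<gamma> (x + real (n + i) * \<gamma>) m = walk \<gamma> (x + real n * \<gamma>) m))"
proof -
  have bad2: "badly_approximable (c / 2) \<gamma>"
    using badly_approximable_double[OF bad] by (simp add: \<gamma>_def)
  have c: "0 < c" using bad by (simp add: badly_approximable_def)
  have c1: "c \<le> 1 / 2"
  proof -
    have "c / real 1 \<le> \<bar>real 1 * \<alpha> - of_int (round \<alpha>)\<bar>"
      using bad unfolding badly_approximable_def by blast
    also have "\<dots> \<le> 1 / 2" using of_int_round_abs_le[of \<alpha>] by (simp add: abs_minus_commute)
    finally show ?thesis by simp
  qed
  have csq: "0 < c\<^sup>2" "c\<^sup>2 \<le> 1" using c c1 by (auto simp: power2_eq_square mult_le_one)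
  define R where "R = nat \<lceil>32 / c\<^sup>2\<rceil> + 1"
  have R: "32 / c\<^sup>2 < real R" "0 < R" unfolding R_def using csq by (auto, linarith)
  define N0 where "N0 = nat \<lceil>128 / c\<^sup>2\<rceil> + 1"
  have N0: "128 / c\<^sup>2 \<le> real N0" "0 < N0" unfolding N0_def by (auto, linarith)
  \<comment> \<open>It suffices to work at the scales \<open>L = (R + 4) N\<close>. The factor \<open>R\<close> makes the approach to the opposite point
    close enough for \<open>walk_antisymmetry\<close> up to time \<open>m\<close>, and \<open>N \<ge> N0\<close> makes \<open>h\<close> positive.\<close>
  have scale: "\<exists>n m h. c\<^sup>2 * real N / 128 \<le> real h \<and> h \<le> m \<and> n + m + h \<le> (R + 4) * N \<and>
    \<bar>walk \<gamma> (x + real n * \<gamma>) m\<bar> = 1 \<and>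
    (\<forall>i\<le>h. walk \<gamma> (x + real (n + i) * \<gamma>) m = walk \<gamma> (x + real n * \<gamma>) m)"
    if NN: "N0 \<le> N" for N x
  proof -
    have N: "0 < N" "128 / c\<^sup>2 \<le> real N" using NN N0 by auto
    define \<delta> where "\<delta> = 8 / (c * real N)"
    have d: "0 < \<delta>" using c N by (simp add: \<delta>_def)
    obtain n0 z where n0: "n0 < N" "\<bar>\<alpha> + real n0 * \<gamma> - 0 - of_int z\<bar> \<le> 2 / (c / 2 * real N)"
      using orbit_near_every_point[OF bad2 N(1)] by blast
    define m where "m = 2 * n0 + 1"
    have m: "odd m" "m \<le> 2 * N" "1 \<le> m" using n0 by (auto simp: m_def)
    have mz: "\<bar>real m * \<alpha> - of_int z\<bar> \<le> 4 / (c * real N)"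
      using n0(2) by (simp add: m_def \<gamma>_def algebra_simps)
    have mlow: "c\<^sup>2 * real N / 4 \<le> real m"
    proof -
      have "c / real m \<le> 4 / (c * real N)"
        using bad m(3) mz unfolding badly_approximable_def by (meson order.trans)
      then show ?thesis using c N m by (simp add: field_simps power2_eq_square)
    qed
    have mgam: "\<bar>real m * \<gamma> - 2 * of_int z\<bar> \<le> \<delta>"
      using mz by (simp add: \<gamma>_def \<delta>_def abs_le_iff)
    obtain k z' where k: "k < R * N" "\<bar>0 + real k * \<alpha> - 1 / 2 - of_int z'\<bar> \<le> 2 / (c * real (R * N))"
      using orbit_near_every_point[OF bad, of "R * N"] R N by (metis nat_0_less_mult_iff)
    define h where "h = nat \<lfloor>c\<^sup>2 * real N / 64\<rfloor>"
    have h: "real h \<le> c\<^sup>2 * real N / 64" "c\<^sup>2 * real N / 64 - 1 < real h"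
  proof -
      have "0 \<le> c\<^sup>2 * real N / 64" by simp
      then show "real h \<le> c\<^sup>2 * real N / 64" "c\<^sup>2 * real N / 64 - 1 < real h"
        unfolding h_def by linarith+
    qed
    have "2 \<le> c\<^sup>2 * real N / 64" using N csq by (simp add: field_simps)
    then have hlow: "c\<^sup>2 * real N / 128 \<le> real h" using h(2) by simp
    have "real h \<le> real N" using h(1) csq mult_right_mono[OF csq(2), of "real N"] by simp
    then have hN: "h \<le> N" by simp
    have hm: "h \<le> m"
    proof -
      have "real h \<le> real m" using h(1) mlow csq by linarith
      then show ?thesis by simp
    qed
    \<comment> \<open>the offset \<open>h\<close> leaves room for a stretch that ends, rather than starts, at the chosen instant\<close>
    define v where "v n = walk \<gamma> (x + real (h + n) * \<gamma>) m" for n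
    define jump where
      "jump n \<longleftrightarrow> step (x + real (n + m) * \<gamma>) \<noteq> step (x + real n * \<gamma>)" for n
    have jump_near: "\<exists>w::int. \<bar>x + real n * \<gamma> - of_int w\<bar> \<le> \<delta>" if "jump n" for n
    proof (rule step_differs_near_integer)
      show "step (x + real n * \<gamma>) \<noteq> step (x + real (n + m) * \<gamma>)"
        using that by (simp add: jump_def)
      show "\<bar>x + real n * \<gamma> - (x + real (n + m) * \<gamma>) - 2 * of_int (- z)\<bar> \<le> \<delta>"
        using mgam by (simp add: algebra_simps)
    qed
    have jump_gap: "2 * h \<le> j - i" if "jump i" "jump j" "i < j" for i j
    proof -
      have "c / 2 \<le> 2 * \<delta> * real (j - i)"
        using close_integers_far_in_time[OF bad2 that(3)] jump_near[OF that(1)] jump_near[OF that(2)]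
        by blast
      then have "c\<^sup>2 * real N / 32 \<le> real (j - i)"
        using c N by (simp add: \<delta>_def field_simps power2_eq_square)
      then have "real (2 * h) \<le> real (j - i)" using h(1) by simp
      then show ?thesis by linarith
    qed
    have no_jump: "walk \<gamma> (x + real (Suc n) * \<gamma>) m = walk \<gamma> (x + real n * \<gamma>) m"
      if "\<not> jump n" for n
      using walk_shift_difference[of \<gamma> x n m] that by (simp add: jump_def)
    have plateau: "walk \<gamma> (x + real (n + i) * \<gamma>) m = walk \<gamma> (x + real n * \<gamma>) m"
      if "\<And>j. n \<le> j \<Longrightarrow> j < n + h \<Longrightarrow> \<not> jump j" "i \<le> h" for n i
      using that(2)
    proof (induction i)
      case (Suc i)
      then have "\<not> jump (n + i)" using that(1)[of "n + i"] by simp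
      from no_jump[OF this] show ?case using Suc by simp
    qed simp
    have "\<exists>n\<le>k. \<bar>v n\<bar> = 1"
    proof (rule discrete_intermediate_value)
      show "odd (v n)" for n using m(1) by (simp add: v_def even_walk_iff)
      show "\<bar>v (Suc n) - v n\<bar> \<le> 2" for n
        using walk_shift_difference[of \<gamma> x "h + n" m] by (simp add: v_def step_def)
      define \<delta>' where "\<delta>' = 4 / (c * real (R * N))"
      show "\<bar>v k + v 0\<bar> \<le> 2"
        unfolding v_def
      proof (rule walk_antisymmetry[OF bad2])
        show "\<bar>x + real (h + k) * \<gamma> - (x + real (h + 0) * \<gamma> + 1) - 2 * of_int z'\<bar> \<le> \<delta>'"
          using k(2) by (simp add: \<gamma>_def \<delta>'_def algebra_simps abs_le_iff)
        have "2 * \<delta>' * real m \<le> 2 * \<delta>' * real (2 * N)"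
          using m c by (intro mult_left_mono) (auto simp: \<delta>'_def)
        also have "\<dots> = 16 / (c * real R)" using N c by (simp add: \<delta>'_def)
        also have "\<dots> < c / 2" using R c csq by (simp add: field_simps power2_eq_square)
        finally show "2 * \<delta>' * real m < c / 2" .
      qed
    qed
    then obtain n1 where n1: "n1 \<le> k" "\<bar>v n1\<bar> = 1" by blast
    show ?thesis
    proof (cases "\<exists>j. h + n1 \<le> j \<and> j < h + n1 + h \<and> jump j")
      case False
      have "h + n1 + m + h \<le> (R + 4) * N"
        using n1 k m hN by (simp add: algebra_simps)
      then show ?thesis
        using False plateau[of "h + n1"] n1(2) hlow hm unfolding v_def by blast
    next
      case True
      then obtain j where j: "h + n1 \<le> j" "j < h + n1 + h" "jump j" by blast
      have "\<not> jump i" if "n1 \<le> i" "i < n1 + h" for i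
        using jump_gap[of i j] j that by auto
      then have con: "walk \<gamma> (x + real (n1 + i) * \<gamma>) m = walk \<gamma> (x + real n1 * \<gamma>) m" if "i \<le> h" for i
        using plateau that by blast
      have "n1 + m + h \<le> (R + 4) * N"
        using n1 k m hN by (simp add: algebra_simps)
      moreover have "\<bar>walk \<gamma> (x + real n1 * \<gamma>) m\<bar> = 1"
        using con[of h] n1(2) by (simp add: v_def add.commute)
      ultimately show ?thesis using con hlow hm by blast
    qed
  qed
  define Q where "Q = R + 4"
  have Q: "0 < Q" by (simp add: Q_def)
  show ?thesis
  proof (rule exI[of _ "c\<^sup>2 / (256 * real Q)"], rule exI[of _ "Q * N0"], intro conjI allI impI)
    show "0 < c\<^sup>2 / (256 * real Q)" using csq Q by simp
    fix L :: nat and x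
    assume L: "Q * N0 \<le> L"
    define N where "N = L div Q"
    have NN: "N0 \<le> N" using L Q by (metis N_def div_le_mono nonzero_mult_div_cancel_left not_gr0)
    have QN: "Q * N \<le> L" by (simp add: N_def)
    have "L < Q * (N + 1)"
      using Q by (simp add: N_def algebra_simps) (metis dividend_less_times_div mult.commute)
    also have "\<dots> \<le> Q * (2 * N)" using NN N0 by (intro mult_left_mono) auto
    finally have "real L \<le> 2 * real Q * real N" by (metis less_imp_le mult.assoc mult.left_commute of_nat_le_iff of_nat_mult of_nat_numeral)
    then have "c\<^sup>2 / (256 * real Q) * real L \<le> c\<^sup>2 / (256 * real Q) * (2 * real Q * real N)"
      using csq by (intro mult_left_mono) auto
    also have "\<dots> = c\<^sup>2 * real N / 128" using Q by (simp add: field_simps)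
    finally have "c\<^sup>2 / (256 * real Q) * real L \<le> c\<^sup>2 * real N / 128" .
    then show "\<exists>n m h. c\<^sup>2 / (256 * real Q) * real L \<le> real h \<and> h \<le> m \<and> n + m + h \<le> L \<and>
      \<bar>walk \<gamma> (x + real n * \<gamma>) m\<bar> = 1 \<and>
      (\<forall>i\<le>h. walk \<gamma> (x + real (n + i) * \<gamma>) m = walk \<gamma> (x + real n * \<gamma>) m)"
      using scale[OF NN, of x] QN unfolding Q_def[symmetric] by (meson order.trans)
  qed
qed

section \<open>Decay of exponential sums along the walk\<close>

lemma powr_le_tangent:
  fixes t p :: real
  assumes "0 \<le> t" "0 \<le> p" "p \<le> 1"
  shows "t powr p \<le> 1 + p * (t - 1)"
proof (cases "t = 0")
  case False
  have cvx: "convex_on UNIV (exp :: real \<Rightarrow> real)" by (rule exp_convex)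
  have "exp ((1 - p) * 0 + p * ln t) \<le> (1 - p) * exp 0 + p * exp (ln t)"
    using convex_onD[OF cvx assms(2,3), of 0 "ln t"] by simp
  then show ?thesis using False assms by (simp add: powr_def algebra_simps)
qed (use assms in simp)

text \<open>Concavity of \<open>a \<mapsto> a powr p\<close>, used through its tangent at the mean \<open>L / 5\<close>: cutting a length \<open>L\<close> into five
  pieces costs only a factor \<open>5 powr (1 - p)\<close>, which is \<open>1 + O(1 - p)\<close>.\<close>
lemma sum_five_powr_le:
  fixes p L :: real
  assumes "0 \<le> p" "p \<le> 1" "0 < L" and nonneg: "\<forall>a\<in>set as. 0 \<le> a"
    and "length as = 5" and "sum_list as = L"
  shows "(\<Sum>a\<leftarrow>as. a powr p) \<le> (1 + 4 * (1 - p)) * L powr p"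
proof -
  have "(\<Sum>a\<leftarrow>as. (5 * a / L) powr p) \<le> (\<Sum>a\<leftarrow>as. 1 + p * (5 * a / L - 1))"
    using assms by (intro sum_list_mono powr_le_tangent) auto
  also have "\<dots> = length as + p * (5 * sum_list as / L - length as)"
    by (induction as) (auto simp: algebra_simps add_divide_distrib)
  also have "\<dots> = 5" using assms by simp
  finally have *: "(\<Sum>a\<leftarrow>as. (5 * a / L) powr p) \<le> 5" .
  have "(\<Sum>a\<leftarrow>as. a powr p) = (\<Sum>a\<leftarrow>as. (L / 5) powr p * (5 * a / L) powr p)"
  proof (intro arg_cong[of _ _ sum_list] map_cong HOL.refl)
    fix a assume "a \<in> set as"
    then have "0 \<le> 5 * a / L" "0 \<le> L / 5" using assms(3) nonneg by auto
    then have "(L / 5) powr p * (5 * a / L) powr p = (L / 5 * (5 * a / L)) powr p"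
      by (intro powr_mult[symmetric])
    then show "a powr p = (L / 5) powr p * (5 * a / L) powr p" using assms(3) by simp
  qed
  also have "\<dots> = (L / 5) powr p * (\<Sum>a\<leftarrow>as. (5 * a / L) powr p)"
    by (simp add: sum_list_const_mult)
  also have "\<dots> \<le> (L / 5) powr p * 5" using * by (intro mult_left_mono) auto
  also have "\<dots> = 5 powr (1 - p) * L powr p"
    using assms by (simp add: powr_divide powr_diff)
  also have "\<dots> \<le> (1 + 4 * (1 - p)) * L powr p"
    using powr_le_tangent[of 5 "1 - p"] assms by (intro mult_right_mono) (auto simp: algebra_simps)
  finally show ?thesis .
qed

definition walk_exp_sum :: "real \<Rightarrow> real \<Rightarrow> real \<Rightarrow> nat \<Rightarrow> complex" where
  "walk_exp_sum \<gamma> \<theta> x n = (\<Sum>i<n. cis (\<theta> * of_int (walk \<gamma> x i)))"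

lemma walk_exp_sum_add:
  "walk_exp_sum \<gamma> \<theta> x (m + n) = walk_exp_sum \<gamma> \<theta> x m +
     cis (\<theta> * of_int (walk \<gamma> x m)) * walk_exp_sum \<gamma> \<theta> (x + real m * \<gamma>) n"
proof (induction n)
  case (Suc n)
  have "cis (\<theta> * of_int (walk \<gamma> x (m + n))) =
      cis (\<theta> * of_int (walk \<gamma> x m)) * cis (\<theta> * of_int (walk \<gamma> (x + real m * \<gamma>) n))"
    by (simp add: walk_add[of _ _ m] cis_mult distrib_left)
  then show ?case using Suc by (simp add: walk_exp_sum_def distrib_left)
qed (simp add: walk_exp_sum_def)

text \<open>The bound is uniform up to \<open>\<bar>\<theta>\<bar> = pi\<close>. For a level difference \<open>v\<close> with \<open>\<bar>v\<bar> \<ge> 2\<close> the analogous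
  factor \<open>\<bar>1 + e\<^sup>i\<^sup>v\<^sup>\<theta>\<bar>\<close> would return to \<open>2\<close> at \<open>\<theta> = 2 pi / v\<close>.\<close>
lemma norm_one_plus_cis_le:
  fixes \<theta> :: real
  assumes "\<bar>\<theta>\<bar> \<le> pi"
  shows "norm (1 + cis \<theta>) \<le> 2 - \<theta>\<^sup>2 / 16"
proof -
  define y where "y = \<theta> / 4"
  have y: "\<bar>y\<bar> \<le> 1" using assms pi_less_4 by (simp add: y_def)
  have "1 + cis \<theta> = cis (\<theta> / 2) * (cis (- (\<theta> / 2)) + cis (\<theta> / 2))"
    by (simp add: distrib_left cis_mult)
  also have "cis (- (\<theta> / 2)) + cis (\<theta> / 2) = of_real (2 * cos (\<theta> / 2))"
    by (simp add: complex_eq_iff)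
  finally have "norm (1 + cis \<theta>) = 2 * \<bar>cos (\<theta> / 2)\<bar>" by (simp add: norm_mult)
  also have "\<bar>cos (\<theta> / 2)\<bar> = cos (2 * y)"
    using cos_ge_zero[of "\<theta> / 2"] assms by (simp add: y_def)
  also have "cos (2 * y) = 1 - 2 * (sin y)\<^sup>2" by (rule cos_double_sin)
  also have "(y / 2)\<^sup>2 \<le> (sin y)\<^sup>2"
  proof -
    have "\<bar>y\<bar> / 2 \<le> sin \<bar>y\<bar>"
    proof -
      have "\<bar>y\<bar> ^ 3 \<le> \<bar>y\<bar>" using y power_decreasing[of 1 3 "\<bar>y\<bar>"] by simp
      moreover have "\<bar>sin \<bar>y\<bar> - \<bar>y\<bar>\<bar> \<le> \<bar>y\<bar> ^ 3 / 6"
        using Maclaurin_sin_bound[of "\<bar>y\<bar>" 3]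
        by (simp add: sin_coeff_def eval_nat_numeral field_simps)
      ultimately show ?thesis by linarith
    qed
    also have "\<dots> \<le> \<bar>sin y\<bar>" by (auto simp: abs_if)
    finally have "\<bar>y / 2\<bar> \<le> \<bar>sin y\<bar>" by simp
    then show ?thesis by (simp only: abs_le_square_iff)
  qed
  then have "2 * (1 - 2 * (sin y)\<^sup>2) \<le> 2 - \<theta>\<^sup>2 / 16"
    by (simp add: y_def power2_eq_square)
  finally show ?thesis .
qed

lemma walk_exp_sum_repeated:
  assumes con: "\<And>i. i \<le> h \<Longrightarrow> walk \<gamma> (x + real i * \<gamma>) m = walk \<gamma> x m"
  shows "walk_exp_sum \<gamma> \<theta> (x + real m * \<gamma>) h = walk_exp_sum \<gamma> \<theta> x h"
  unfolding walk_exp_sum_def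
proof (rule sum.cong[OF HOL.refl])
  fix i assume "i \<in> {..<h}"
  then have "walk \<gamma> x (i + m) = walk \<gamma> x i + walk \<gamma> x m"
    using con[of i] by (simp add: walk_add)
  moreover have "walk \<gamma> x (i + m) = walk \<gamma> x m + walk \<gamma> (x + real m * \<gamma>) i"
    by (subst add.commute) (rule walk_add)
  ultimately show "cis (\<theta> * of_int (walk \<gamma> (x + real m * \<gamma>) i)) = cis (\<theta> * of_int (walk \<gamma> x i))"
    by simp
qed

text \<open>Induction on \<open>L\<close>, simultaneously for all starting points. A stretch of length \<open>L\<close> is cut into five pieces,
  two of which carry the same word of length \<open>h \<ge> \<kappa> L\<close>, at levels that differ by one. Together these two
  contribute at most \<open>\<bar>1 + e\<^sup>i\<^sup>\<theta>\<bar> \<le> 2 - \<theta>\<^sup>2 / 16\<close> times the bound for one of them. With the exponent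
  \<open>p = 1 - \<epsilon> \<theta>\<^sup>2\<close> this gain, of relative size \<open>\<kappa> \<theta>\<^sup>2 / 16\<close>, compensates the loss \<open>4 (1 - p) = 4 \<epsilon> \<theta>\<^sup>2\<close> that is
  caused by the cutting, if \<open>\<epsilon> = \<kappa> / 64\<close>.\<close>
lemma walk_exp_sum_decay:
  assumes bad: "badly_approximable c \<alpha>"
  defines "\<gamma> \<equiv> 2 * \<alpha>"
  obtains K \<epsilon> where "0 < K" "0 < \<epsilon>" "\<epsilon> * pi\<^sup>2 \<le> 1"
    "\<And>\<theta> x L. \<bar>\<theta>\<bar> \<le> pi \<Longrightarrow> norm (walk_exp_sum \<gamma> \<theta> x L) \<le> K * real L powr (1 - \<epsilon> * \<theta>\<^sup>2)"
proof -
  obtain \<kappa> L0 where \<kappa>: "0 < \<kappa>" and rep: "\<And>L x. L0 \<le> L \<Longrightarrow> \<exists>n m h. \<kappa> * real L \<le> real h \<and>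
      h \<le> m \<and> n + m + h \<le> L \<and> \<bar>walk \<gamma> (x + real n * \<gamma>) m\<bar> = 1 \<and>
      (\<forall>i\<le>h. walk \<gamma> (x + real (n + i) * \<gamma>) m = walk \<gamma> (x + real n * \<gamma>) m)"
    using repeated_word[OF bad] unfolding \<gamma>_def by blast
  have \<kappa>1: "\<kappa> \<le> 1"
  proof -
    obtain n m h where "\<kappa> * real (Suc L0) \<le> real h" "n + m + h \<le> Suc L0"
      using rep[of "Suc L0" 0] by (meson le_SucI order_refl)
    then have "\<kappa> * real (Suc L0) \<le> real h" "h \<le> Suc L0" by linarith+
    then have "real h \<le> 1 * real (Suc L0)" by (simp only: mult_1 of_nat_le_iff)
    with \<open>\<kappa> * real (Suc L0) \<le> real h\<close>    have "\<kappa> * real (Suc L0) \<le> 1 * real (Suc L0)" by (rule order.trans)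
    then show ?thesis by (rule mult_right_le_imp_le) simp
  qed
  define K where "K = real L0 + 1"
  define \<epsilon> where "\<epsilon> = \<kappa> / 64"
  have K: "1 \<le> K" by (simp add: K_def)
  have pi2: "pi\<^sup>2 \<le> 16"
  proof -
    have "pi\<^sup>2 \<le> 4\<^sup>2" using pi_less_4 by (intro power_mono) auto
    then show ?thesis by simp
  qed
  show ?thesis
  proof (rule that[of K \<epsilon>])
    show "0 < K" "0 < \<epsilon>" using K \<kappa> by (auto simp: \<epsilon>_def)
    show "\<epsilon> * pi\<^sup>2 \<le> 1"
      using mult_mono[of \<epsilon> "1 / 64" "pi\<^sup>2" 16] pi2 \<kappa>1 by (simp add: \<epsilon>_def)
    fix \<theta> x :: real and L :: nat
    assume \<theta>: "\<bar>\<theta>\<bar> \<le> pi"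
    define p where "p = 1 - \<epsilon> * \<theta>\<^sup>2"
    have "\<theta>\<^sup>2 \<le> pi\<^sup>2" using \<theta> by (metis abs_le_square_iff abs_of_pos pi_gt_zero)
    then have "\<epsilon> * \<theta>\<^sup>2 \<le> 1"
      using \<open>\<epsilon> * pi\<^sup>2 \<le> 1\<close> mult_left_mono[of "\<theta>\<^sup>2" "pi\<^sup>2" \<epsilon>] \<open>0 < \<epsilon>\<close> by linarith
    then have p: "0 \<le> p" "p \<le> 1" using \<open>0 < \<epsilon>\<close> by (auto simp: p_def)
    define E where "E = walk_exp_sum \<gamma> \<theta>"
    have trivial: "norm (E x L) \<le> real L" for x L
      unfolding E_def walk_exp_sum_def using norm_sum[of "\<lambda>i. cis (\<theta> * of_int (walk \<gamma> x i))" "{..<L}"]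
      by simp
    have "norm (E x L) \<le> K * real L powr p"
    proof (induction L arbitrary: x rule: less_induct)
      case (less L)
      show ?case
      proof (cases "L0 < L")
        case False
        show ?thesis
        proof (cases "L = 0")
          case True
          then show ?thesis using trivial[of x 0] by simp
        next
          case nz: False
          then have "1 \<le> real L powr p" using p by (intro ge_one_powr_ge_zero) auto
          then have "K * 1 \<le> K * real L powr p" using K by (intro mult_left_mono) auto
          moreover have "norm (E x L) \<le> K" using trivial[of x L] False by (simp add: K_def)
          ultimately show ?thesis by simp
        qed
      next
        case True
        obtain n m h where r: "\<kappa> * real L \<le> real h" "h \<le> m" "n + m + h \<le> L"
            "\<bar>walk \<gamma> (x + real n * \<gamma>) m\<bar> = 1"
            "\<And>i. i \<le> h \<Longrightarrow> walk \<gamma> (x + real (n + i) * \<gamma>) m = walk \<gamma> (x + real n * \<gamma>) m"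
          using rep[of L x] True by auto
        have L: "0 < L" using True by simp
        define u where "u = x + real n * \<gamma>"
        define v where "v = walk \<gamma> u m"
        define g where "g = m - h"
        define l where "l = L - (n + m + h)"
        have lens: "m = h + g" "L = n + (h + (g + (h + l)))" using r by (auto simp: g_def l_def)
        have "0 < h" using r(1) \<kappa> L by (metis gr0I mult_pos_pos not_le of_nat_0 of_nat_0_less_iff)
        then have small: "n < L" "g < L" "l < L" "h < L \<or> h = L" using lens by auto
        have hL: "h < L" using lens r(2) \<open>0 < h\<close> by linarith
        have repE: "E (u + real m * \<gamma>) h = E u h"
          unfolding E_def
          by (rule walk_exp_sum_repeated) (use r(5) in \<open>simp add: u_def algebra_simps\<close>)
        \<comment> \<open>the pieces: a head, the word, the gap, the word again, the tail; the two words are taken together\<close>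
        have decomposition: "E x L = E x n + cis (\<theta> * of_int (walk \<gamma> x n)) *
            ((1 + cis (\<theta> * of_int v)) * E u h +
             cis (\<theta> * of_int (walk \<gamma> u h)) * E (u + real h * \<gamma>) g +
             cis (\<theta> * of_int (walk \<gamma> u (m + h))) * E (u + real (m + h) * \<gamma>) l)"
        proof -
          have "E x L = E x n + cis (\<theta> * of_int (walk \<gamma> x n)) * E u (m + h + l)"
            unfolding E_def u_def walk_exp_sum_add[symmetric] using lens by (simp add: add.assoc)
          also have "E u (m + h + l) = E u m + cis (\<theta> * of_int v) * E u h +
              cis (\<theta> * of_int (walk \<gamma> u (m + h))) * E (u + real (m + h) * \<gamma>) l"
            using repE unfolding E_def walk_exp_sum_add[of _ _ u "m + h"] walk_exp_sum_add[of _ _ u m] v_def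
            by simp
          also have "E u m = E u h + cis (\<theta> * of_int (walk \<gamma> u h)) * E (u + real h * \<gamma>) g"
            unfolding E_def lens(1) walk_exp_sum_add ..
          finally show ?thesis by (simp add: algebra_simps)
        qed
        have gain: "norm (1 + cis (\<theta> * of_int v)) \<le> 2 - \<theta>\<^sup>2 / 16"
        proof -
          have "v = 1 \<or> v = - 1" using r(4) by (auto simp: v_def u_def)
          then show ?thesis using norm_one_plus_cis_le[of \<theta>] norm_one_plus_cis_le[of "- \<theta>"] \<theta> by auto
        qed
        have "norm (E x L) \<le> norm (E x n) + (norm (1 + cis (\<theta> * of_int v)) * norm (E u h) +
            norm (E (u + real h * \<gamma>) g) + norm (E (u + real (m + h) * \<gamma>) l))"
          unfolding decomposition
          by (rule order.trans[OF norm_triangle_ineq] add_left_mono)+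
            (auto simp: norm_mult intro!: order.trans[OF norm_triangle_ineq] add_mono)
        also have "\<dots> \<le> K * real n powr p + ((2 - \<theta>\<^sup>2 / 16) * (K * real h powr p) +
            K * real g powr p + K * real l powr p)"
          using less.IH small hL gain order.trans[OF norm_ge_zero gain]
          by (intro add_mono mult_mono) auto
        also have "\<dots> = K * ((\<Sum>a\<leftarrow>[real n, real h, real g, real h, real l]. a powr p) -
            \<theta>\<^sup>2 / 16 * real h powr p)"
          by (simp add: algebra_simps)
        also have "\<dots> \<le> K * ((1 + 4 * (1 - p)) * real L powr p - \<theta>\<^sup>2 / 16 * (\<kappa> * real L powr p))"
        proof (intro mult_left_mono diff_mono)
          show "(\<Sum>a\<leftarrow>[real n, real h, real g, real h, real l]. a powr p) \<le> (1 + 4 * (1 - p)) * real L powr p"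
            using p L by (intro sum_five_powr_le) (auto simp: lens(2))
          have "\<kappa> * real L powr p \<le> \<kappa> powr p * real L powr p"
            using powr_mono'[of p 1 \<kappa>] p \<kappa> \<kappa>1 by (intro mult_right_mono) auto
          also have "\<dots> = (\<kappa> * real L) powr p" using \<kappa> by (simp add: powr_mult)
          also have "\<dots> \<le> real h powr p" using r(1) \<kappa> p by (intro powr_mono2) auto
          finally show "\<kappa> * real L powr p \<le> real h powr p" .
        qed (use K in auto)
        also have "\<dots> = K * real L powr p"
          by (simp add: p_def \<epsilon>_def field_simps)
        finally show ?thesis .
      qed
    qed
    then show "norm (walk_exp_sum \<gamma> \<theta> x L) \<le> K * real L powr (1 - \<epsilon> * \<theta>\<^sup>2)"
      by (simp add: E_def p_def)
  qed
qed

section \<open>Trajectories of the flow on the staircase\<close>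

text \<open>A complete invariant of the gluing: right edges are moved to left edges, top edges to bottom edges of
  the neighbouring rectangles, and of a singular corner only the parity of the level is kept, since the
  corners \<open>(0, 0)\<close> and \<open>(1, 0)\<close> of levels of equal parity are the same singularity.\<close>
fun normal_form :: "int \<times> real \<times> real \<Rightarrow> int \<times> real \<times> real" where
  "normal_form (k, x, y) =
     (let x' = (if x = 2 then 0 else x);
          (k', x'', y') =
            (if y \<noteq> 1 then (k, x', y)
             else if x' < 1 then (k - 1, x' + 1, 0) else (k + 1, x' - 1, 0))
      in (if y' = 0 \<and> (x'' = 0 \<or> x'' = 1) then (k' mod 2, x'', y') else (k', x'', y')))"

lemma normal_form_glue: "glue r s \<Longrightarrow> normal_form r = normal_form s"
proof (induction rule: glue.induct)
  case (up x k)
  have "(k - 1) mod 2 = (k + 1) mod 2" by presburger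
  then show ?case using up by (auto simp: Let_def)
next
  case (down x k)
  have "(k - 1) mod 2 = (k + 1) mod 2" by presburger
  then show ?case using down by (auto simp: Let_def)
qed (auto simp: Let_def)

lemma glue_in_rect: "glue r s \<Longrightarrow> in_rect r \<and> in_rect s"
  by (induction rule: glue.induct) (auto simp: in_rect_def)

lemma glue_imp_pt_eq: "glue (k, x, y) (k', x', y') \<Longrightarrow> pt k x y = pt k' x' y'"
  unfolding pt_def using Quotient3_rel_abs[OF Quotient3_stair] by blast

lemma pt_eq_imp_normal_form_eq:
  assumes "pt k x y = pt k' x' y'" "in_rect (k, x, y)" "in_rect (k', x', y')"
  shows "normal_form (k, x, y) = normal_form (k', x', y')"
proof (rule normal_form_glue)
  show "glue (k, x, y) (k', x', y')"
    using Quotient3_rel[OF Quotient3_stair, of "(k, x, y)" "(k', x', y')"]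
      glue.refl[OF assms(2)] glue.refl[OF assms(3)] assms(1) by (simp add: pt_def)
qed

lemma pt_top_left: "0 \<le> x \<Longrightarrow> x \<le> 1 \<Longrightarrow> pt k x 1 = pt (k - 1) (x + 1) 0"
  by (intro glue_imp_pt_eq glue.down)

lemma pt_top_right: "1 \<le> x \<Longrightarrow> x \<le> 2 \<Longrightarrow> pt k x 1 = pt (k + 1) (x - 1) 0"
  by (intro glue_imp_pt_eq glue.up)

lemma pt_side: "0 \<le> y \<Longrightarrow> y \<le> 1 \<Longrightarrow> pt k 2 y = pt k 0 y"
  by (intro glue_imp_pt_eq glue.sym[OF glue.side])

lemma stair_cases:
  obtains k x y where "p = pt k x y" "0 \<le> x" "x < 2" "0 \<le> y" "y < 1"
proof -
  note found = that
  have half_open: thesis if "p = pt k x y" "0 \<le> x" "x \<le> 2" "0 \<le> y" "y < 1" for k x y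
  proof (cases "x = 2")
    case True
    then show ?thesis using found[of k 0 y] that pt_side[of y k] by simp
  next
    case False
    then show ?thesis using found[of k x y] that by simp
  qed
  obtain k x y where r: "rep_stair p = (k, x, y)" by (metis prod_cases3)
  have "glue (rep_stair p) (rep_stair p)"
    using Quotient3_rep_reflp[OF Quotient3_stair] by simp
  then have rect: "0 \<le> x" "x \<le> 2" "0 \<le> y" "y \<le> 1"
    using glue_in_rect unfolding r by (auto simp: in_rect_def)
  have p: "p = pt k x y"
    unfolding pt_def r[symmetric] using Quotient3_abs_rep[OF Quotient3_stair] by metis
  consider "y < 1" | "y = 1" "x \<le> 1" | "y = 1" "1 \<le> x" using rect by linarith
  then show ?thesis
  proof cases
    case 1
    then show ?thesis using half_open[OF p] rect by simp
  next
    case 2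
    then show ?thesis using half_open[of "k - 1" "x + 1" 0] pt_top_left[of x k] p rect by simp
  next
    case 3
    then show ?thesis using half_open[of "k + 1" "x - 1" 0] pt_top_right[of x k] p rect by simp
  qed
qed

lemma singular_pt_iff:
  assumes "0 \<le> x" "x < 2" "0 \<le> y" "y < 1"
  shows "pt k x y \<in> singularities \<longleftrightarrow> y = 0 \<and> (x = 0 \<or> x = 1)"
proof
  assume "pt k x y \<in> singularities"
  then obtain k' x' y' where s: "pt k x y = pt k' x' y'" "x' \<in> {0, 1, 2}" "y' \<in> {0, 1}"
    by (auto simp: singularities_def)
  have "normal_form (k, x, y) = normal_form (k', x', y')"
    using assms s by (intro pt_eq_imp_normal_form_eq) (auto simp: in_rect_def)
  then show "y = 0 \<and> (x = 0 \<or> x = 1)"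
    using assms s by (auto simp: Let_def split: if_splits)
qed (auto simp: singularities_def)

lemma departure_regular:
  assumes "0 \<le> x" "x < 2" "0 \<le> y" "y < 1" "y \<noteq> 0 \<or> x \<noteq> 0 \<and> x \<noteq> 1"
  shows "departure (pt k x y) = (k, x, y)"
proof -
  have ns: "pt k x y \<notin> singularities"
    using assms singular_pt_iff[of x y k] by auto
  have "(THE r. (case r of (k', x', y') \<Rightarrow>
      0 \<le> x' \<and> x' < 2 \<and> 0 \<le> y' \<and> y' < 1 \<and> pt k' x' y' = pt k x y)) = (k, x, y)"
  proof (rule the_equality)
    fix r
    assume "case r of (k', x', y') \<Rightarrow>
      0 \<le> x' \<and> x' < 2 \<and> 0 \<le> y' \<and> y' < 1 \<and> pt k' x' y' = pt k x y"
    then obtain k' x' y' where r: "r = (k', x', y')" "0 \<le> x'" "x' < 2" "0 \<le> y'" "y' < 1"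
        "pt k' x' y' = pt k x y"
      by (cases r) auto
    have "normal_form (k', x', y') = normal_form (k, x, y)"
      using r assms by (intro pt_eq_imp_normal_form_eq) (auto simp: in_rect_def)
    then show "r = (k, x, y)" using r assms by (auto simp: Let_def split: if_splits)
  qed (use assms in simp)
  then show ?thesis using ns by (simp add: departure_def)
qed

lemma singularity_shift_two:
  assumes "x = 0 \<or> x = 1"
  shows "pt (k + 2 * i) x 0 = pt k x 0"
proof -
  have two: "pt (k + 2) x 0 = pt k x 0" for k
  proof (cases "x = 0")
    case True
    have "pt (k + 2) 0 0 = pt (k + 1) 1 1" using pt_top_right[of 1 "k + 1"] by (simp add: add.commute)
    also have "\<dots> = pt k 2 0" using pt_top_left[of 1 "k + 1"] by simp
    finally show ?thesis using True pt_side[of 0 k] by simp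
  next
    case False
    have "pt (k + 2) 1 0 = pt (k + 1) 2 1" using pt_top_right[of 2 "k + 1"] by (simp add: add.commute)
    also have "\<dots> = pt (k + 1) 0 1" by (rule pt_side) auto
    also have "\<dots> = pt k 1 0" using pt_top_left[of 0 "k + 1"] by simp
    finally show ?thesis using False assms by simp
  qed
  show ?thesis
  proof (induction i rule: int_induct[where k = 0])
    case (step1 i)
    then show ?case using two[of "k + 2 * i"] by (simp add: algebra_simps)
  next
    case (step2 i)
    then show ?case using two[of "k + 2 * (i - 1)"] by (simp add: algebra_simps)
  qed simp
qed

text \<open>A trajectory through a singularity stays on the same orbit of the rotation: the prescribed continuation
  only replaces the level of its representative.\<close>
lemma departure_singular:
  assumes "x = 0 \<or> x = 1"
  shows "\<exists>j. departure (pt k x 0) = (j, x, 0)"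
proof -
  let ?C = "{(0, 0, 0), (0, 1, 0), (- 1, 1, 0), (1, 0, 0)} :: (int \<times> real \<times> real) set"
  have sing: "pt k x 0 \<in> singularities" using assms by (auto simp: singularities_def)
  have rect: "in_rect r" if "r \<in> ?C" for r using that by (auto simp: in_rect_def)
  have nf: "normal_form r = normal_form (k, x, 0)" if "r \<in> ?C" "abs_stair r = pt k x 0" for r
    using pt_eq_imp_normal_form_eq[of "fst r" "fst (snd r)" "snd (snd r)" k x 0] that rect[OF that(1)] assms
    by (auto simp: pt_def in_rect_def)
  have inj: "r = s" if "r \<in> ?C" "s \<in> ?C" "normal_form r = normal_form s" for r s
    using that by (auto simp: Let_def)
  have "\<exists>j. (j, x, 0) \<in> ?C \<and> pt j x 0 = pt k x 0"
  proof (cases "even k")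
    case True
    then have "pt 0 x 0 = pt k x 0"
      using singularity_shift_two[OF assms, of 0 "k div 2"] by simp
    then show ?thesis using assms by auto
  next
    case False
    then have "pt 1 x 0 = pt k x 0" "pt (- 1) x 0 = pt k x 0"
      using singularity_shift_two[OF assms, of 1 "k div 2"]
        singularity_shift_two[OF assms, of "- 1" "k div 2 + 1"] by (auto elim!: oddE simp: add.commute)
    then show ?thesis using assms by auto
  qed
  then obtain j where j: "(j, x, 0) \<in> ?C" "pt j x 0 = pt k x 0" by blast
  have "(THE r. r \<in> ?C \<and> abs_stair r = pt k x 0) = (j, x, 0)"
  proof (rule the_equality)
    show "(j, x, 0) \<in> ?C \<and> abs_stair (j, x, 0) = pt k x 0" using j by (simp add: pt_def)
    fix r
    assume r: "r \<in> ?C \<and> abs_stair r = pt k x 0"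
    show "r = (j, x, 0)"
      using inj[of r "(j, x, 0)"] nf[of r] nf[of "(j, x, 0)"] r j by (simp add: pt_def)
  qed
  then show ?thesis using sing by (auto simp: departure_def)
qed

lemma departure_exists:
  obtains k x y where "departure p = (k, x, y)" "0 \<le> x" "x < 2" "0 \<le> y" "y < 1"
proof -
  obtain k x y where p: "p = pt k x y" "0 \<le> x" "x < 2" "0 \<le> y" "y < 1" by (rule stair_cases)
  show ?thesis
  proof (cases "y = 0 \<and> (x = 0 \<or> x = 1)")
    case True
    then obtain j where "departure p = (j, x, 0)" using departure_singular[of x k] p by auto
    then show ?thesis using that p by simp
  next
    case False
    then show ?thesis using that departure_regular[of x y k] p by auto
  qed
qed

lemma interior_horizontal_rect_iff:
  assumes "0 \<le> x" "x < 2" "0 < y" "y < 1"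
  shows "pt k x y \<in> horizontal_rect j \<longleftrightarrow> k = j"
proof
  assume "pt k x y \<in> horizontal_rect j"
  then obtain x' y' where r: "in_rect (j, x', y')" "pt j x' y' = pt k x y" "0 < y'"
    by (auto simp: horizontal_rect_def represents_def)
  have "normal_form (j, x', y') = normal_form (k, x, y)"
    using r assms by (intro pt_eq_imp_normal_form_eq) (auto simp: in_rect_def)
  then show "k = j" using r assms by (auto simp: Let_def in_rect_def split: if_splits)
next
  assume "k = j"
  have "pt k x y \<notin> singularities" using assms singular_pt_iff[of x y k] by auto
  moreover have "represents k x y (pt k x y)" using assms by (simp add: represents_def in_rect_def)
  ultimately show "pt k x y \<in> horizontal_rect j"
    using assms \<open>k = j\<close> unfolding horizontal_rect_def regular_points_def by blast
qed

lemma level_interior: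
  assumes "0 \<le> x" "x < 2" "0 < y" "y < 1"
  shows "level (pt k x y) = k"
  unfolding level_def using interior_horizontal_rect_iff[OF assms] by auto

lemma rise_interior:
  assumes "departure p = (k, x, y)" "0 < y + t" "y + t < 1"
  shows "level (rise \<beta> t p) = k" "rise \<beta> t p \<in> horizontal_rect j \<longleftrightarrow> k = j"
  using assms level_interior[of "(x + \<beta> * t) rmod 2" "y + t" k]
    interior_horizontal_rect_iff[of "(x + \<beta> * t) rmod 2" "y + t" k j]
  by (auto simp: rise_def rmod_nonneg rmod_less)

lemma rmod_2_decompose: obtains z where "x = x rmod 2 + 2 * of_int z"
proof
  show "x = x rmod 2 + 2 * of_int \<lfloor>x / 2\<rfloor>" by (simp add: rmod_conv_frac frac_def)
qed

text \<open>This is where the rotation comes from: modulo \<open>2\<close>, both halves of the top edge are glued by \<open>x \<mapsto> x + 1\<close>,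
  and so are its singular points (the integers), at which the level is dictated by the continuation instead.\<close>
lemma departure_top:
  "\<exists>j. departure (pt k (x rmod 2) 1) = (j, (x + 1) rmod 2, 0) \<and> (x \<notin> \<int> \<longrightarrow> j = k + step x)"
proof -
  define x' where "x' = x rmod 2"
  obtain z where z: "x = x' + 2 * of_int z" unfolding x'_def by (rule rmod_2_decompose)
  have x': "0 \<le> x'" "x' < 2" by (auto simp: x'_def rmod_nonneg rmod_less)
  have st: "step x = step x'" unfolding z by simp
  have int: "x \<in> \<int>" if "x' = 0 \<or> x' = 1" using that z by auto
  have shift: "(x + 1) rmod 2 = (x' + 1) rmod 2"
    unfolding x'_def by (metis rmod_add rmod_rmod)
  show ?thesis
  proof (cases "x' < 1")
    case True
    have top: "pt k x' 1 = pt (k - 1) (x' + 1) 0" using True x' by (intro pt_top_left) auto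
    have "\<lfloor>x'\<rfloor> = 0" using x' True by (intro floor_unique) auto
    then have s: "step x = - 1" unfolding st by (simp add: step_def)
    have m: "(x' + 1) rmod 2 = x' + 1" using True x' by (intro rmod_idem) auto
    show ?thesis
    proof (cases "x' = 0")
      case 0: True
      then obtain j where "departure (pt (k - 1) (x' + 1) 0) = (j, x' + 1, 0)"
        using departure_singular[of "x' + 1" "k - 1"] by auto
      then show ?thesis using int 0 top m shift by (auto simp: x'_def)
    next
      case False
      then have "departure (pt (k - 1) (x' + 1) 0) = (k - 1, x' + 1, 0)"
        using True x' by (intro departure_regular) auto
      then show ?thesis using s top m shift by (auto simp: x'_def)
    qed
  next
    case False
    have top: "pt k x' 1 = pt (k + 1) (x' - 1) 0" using False x' by (intro pt_top_right) auto
    have "\<lfloor>x'\<rfloor> = 1" using x' False by (intro floor_unique) auto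
    then have s: "step x = 1" unfolding st by (simp add: step_def)
    have m: "(x' + 1) rmod 2 = x' - 1"
    proof -
      have "\<lfloor>(x' + 1) / 2\<rfloor> = 1" using False x' by (intro floor_unique) auto
      then show ?thesis by (simp add: rmod_conv_frac frac_def)
    qed
    show ?thesis
    proof (cases "x' = 1")
      case 1: True
      then obtain j where "departure (pt (k + 1) (x' - 1) 0) = (j, x' - 1, 0)"
        using departure_singular[of "x' - 1" "k + 1"] by auto
      then show ?thesis using int 1 top m shift by (auto simp: x'_def)
    next
      case 2: False
      then have "departure (pt (k + 1) (x' - 1) 0) = (k + 1, x' - 1, 0)"
        using False x' by (intro departure_regular) auto
      then show ?thesis using s top m shift by (auto simp: x'_def)
    qed
  qed
qed


text \<open>The level of a trajectory that leaves its first rectangle at the time \<open>h\<close> and then spends a unit of time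
  in each of the following ones.\<close>
definition itinerary :: "real \<Rightarrow> int \<Rightarrow> (nat \<Rightarrow> int) \<Rightarrow> real \<Rightarrow> int" where
  "itinerary h k0 K t = (if t < h then k0 else K (nat \<lfloor>t - h\<rfloor>))"

text \<open>The horizontal coordinate at the successive crossings is the orbit of a rotation by \<open>\<beta> + 1\<close> modulo \<open>2\<close>,
  whatever happens at singularities. As \<open>\<beta>\<close> is irrational, this orbit meets the integers at most once;
  after that time \<open>N\<close> the levels are a walk. The instants \<open>t\<close> with \<open>t - h \<in> \<int>\<close>, at which the trajectory is on
  an edge of a rectangle, are left aside.\<close>
lemma flow_follows_walk:
  fixes \<beta> :: real
  assumes irr: "\<beta> \<notin> \<rat>"
  obtains h k0 N X and K :: "nat \<Rightarrow> int" where "0 < h" "h \<le> 1"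
    "\<And>t j. 0 < t \<Longrightarrow> t - h \<notin> \<int> \<Longrightarrow>
       level (stair_flow \<beta> t \<omega>) = itinerary h k0 K t \<and>
       (stair_flow \<beta> t \<omega> \<in> horizontal_rect j \<longleftrightarrow> itinerary h k0 K t = j)"
    "\<And>n. K (N + n) = K N + walk (\<beta> + 1) X n"
proof -
  obtain k0 x0 y0 where dep: "departure \<omega> = (k0, x0, y0)" "0 \<le> y0" "y0 < 1"
    by (rule departure_exists)
  define h where "h = 1 - y0"
  have h: "0 < h" "h \<le> 1" "time_to_top \<omega> = h" using dep by (auto simp: h_def time_to_top_def)
  define p where "p n = (rise \<beta> 1 ^^ n) (rise \<beta> h \<omega>)" for n
  define Y where "Y = x0 + \<beta> * h"
  define x where "x n = Y + 1 + real n * (\<beta> + 1)" for n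
  define K where "K n = fst (departure (p n))" for n
  have p_Suc: "p (Suc n) = rise \<beta> 1 (p n)" for n by (simp add: p_def)
  have p0: "p 0 = pt k0 (Y rmod 2) 1" using dep by (simp add: p_def rise_def h_def Y_def)
  have add_rmod: "(u rmod 2 + v) rmod 2 = (u + v) rmod 2" for u v :: real
    by (metis rmod_add rmod_rmod)
  have next_top: "rise \<beta> 1 q = pt k ((u + \<beta>) rmod 2) 1" if "departure q = (k, u rmod 2, 0)" for q k u
    using that by (simp add: rise_def add_rmod)
  have dep_p: "departure (p n) = (K n, x n rmod 2, 0)" for n
  proof (induction n)
    case 0
    obtain j where "departure (p 0) = (j, (Y + 1) rmod 2, 0)"
      unfolding p0 using departure_top[of k0 Y] by blast
    then show ?case by (simp add: K_def x_def)
  next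
    case (Suc n)
    obtain j where "departure (p (Suc n)) = (j, (x n + \<beta> + 1) rmod 2, 0)"
      unfolding p_Suc next_top[OF Suc] using departure_top[of "K n" "x n + \<beta>"] by blast
    moreover have "x n + \<beta> + 1 = x (Suc n)" by (simp add: x_def algebra_simps)
    ultimately show ?case by (simp add: K_def)
  qed
  have K_step: "K (Suc n) = K n + step (x n + \<beta>)" if "x n + \<beta> \<notin> \<int>" for n
  proof -
    obtain j where "departure (p (Suc n)) = (j, (x n + \<beta> + 1) rmod 2, 0)" "j = K n + step (x n + \<beta>)"
      unfolding p_Suc next_top[OF dep_p] using departure_top[of "K n" "x n + \<beta>"] \<open>x n + \<beta> \<notin> \<int>\<close> by blast
    then show ?thesis by (simp add: K_def)
  qed
  have once: "i = j" if "x i + \<beta> \<in> \<int>" "x j + \<beta> \<in> \<int>" for i j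
  proof (rule ccontr)
    assume "i \<noteq> j"
    have "(x i + \<beta>) - (x j + \<beta>) \<in> \<int>" using that by (rule Ints_diff)
    then have "(real i - real j) * (\<beta> + 1) \<in> \<rat>"
      using Ints_subset_Rats by (auto simp: x_def algebra_simps)
    then have "(real i - real j) * (\<beta> + 1) / (real i - real j) - 1 \<in> \<rat>"
      by (intro Rats_diff Rats_divide) auto
    then show False using irr \<open>i \<noteq> j\<close> by simp
  qed
  have "\<exists>N. \<forall>n\<ge>N. x n + \<beta> \<notin> \<int>"
  proof (cases "\<exists>i. x i + \<beta> \<in> \<int>")
    case True
    then obtain i where i: "x i + \<beta> \<in> \<int>" by blast
    have "x n + \<beta> \<notin> \<int>" if "Suc i \<le> n" for n
    proof
      assume "x n + \<beta> \<in> \<int>"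
      then have "i = n" using once[OF i] by blast
      then show False using that by simp
    qed
    then show ?thesis by blast
  qed blast
  then obtain N where N: "\<And>n. N \<le> n \<Longrightarrow> x n + \<beta> \<notin> \<int>" by blast
  have K_walk: "K (N + n) = K N + walk (\<beta> + 1) (x N + \<beta>) n" for n
  proof (induction n)
    case (Suc n)
    have eq: "x (N + n) + \<beta> = x N + \<beta> + real n * (\<beta> + 1)" by (simp add: x_def algebra_simps)
    have "K (Suc (N + n)) = K (N + n) + step (x N + \<beta> + real n * (\<beta> + 1))"
      using K_step[OF N[of "N + n"]] unfolding eq by simp
    then show ?case using Suc by (simp add: walk_Suc)
  qed simp
  have location: "level (stair_flow \<beta> t \<omega>) = itinerary h k0 K t \<and>
       (stair_flow \<beta> t \<omega> \<in> horizontal_rect j \<longleftrightarrow> itinerary h k0 K t = j)"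
    if t: "0 < t" "t - h \<notin> \<int>" for t j
  proof (cases "t < h")
    case True
    then have "stair_flow \<beta> t \<omega> = rise \<beta> t \<omega>" by (simp add: stair_flow_def h)
    then show ?thesis
      using True rise_interior[OF dep(1), of t \<beta>] t dep by (simp add: h_def itinerary_def)
  next
    case False
    have "t \<noteq> h" using t by auto
    then have flow: "stair_flow \<beta> t \<omega> = rise \<beta> (frac (t - h)) (p (nat \<lfloor>t - h\<rfloor>))"
      using False by (simp add: stair_flow_def h p_def)
    have "0 < frac (t - h)" "frac (t - h) < 1" using t by (auto simp: frac_lt_1)
    then show ?thesis
      unfolding flow using False rise_interior[OF dep_p, of "frac (t - h)" \<beta>] by (simp add: itinerary_def)
  qed
  show ?thesis by (rule that[OF h(1,2) location K_walk])
qed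

section \<open>From convergence in distribution to local limits\<close>

text \<open>Convergence on bounded intervals suffices because the limit is a probability measure: no mass can escape
  to infinity.\<close>
lemma weak_conv_m_of_intervals:
  fixes P :: "nat \<Rightarrow> real measure"
  assumes P: "\<And>n. real_distribution (P n)" and Q: "real_distribution Q"
    and conv: "\<And>u v. u < v \<Longrightarrow> (\<lambda>n. measure (P n) {u..v}) \<longlonglongrightarrow> measure Q {u..v}"
  shows "weak_conv_m P Q"
  unfolding weak_conv_m_def weak_conv_def
proof (intro allI impI)
  fix x :: real
  interpret Q: real_distribution Q by fact
  show "(\<lambda>n. cdf (P n) x) \<longlonglongrightarrow> cdf Q x"
  proof (rule order_tendstoI)
    fix e assume e: "e < cdf Q x"
    have "(\<lambda>n. measure Q {- real n + x..x}) \<longlonglongrightarrow> measure Q (\<Union>n. {- real n + x..x})"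
      by (intro Lim_measure_incseq) (auto simp: incseq_def)
    moreover have "(\<Union>n. {- real n + x..x}) = {..x}"
    proof (intro set_eqI iffI)
      fix t assume "t \<in> {..x}"
      moreover obtain n where "x - t \<le> real n" using real_arch_simple by blast
      ultimately show "t \<in> (\<Union>n. {- real n + x..x})" by (auto intro!: exI[of _ n])
    qed auto
    ultimately have "(\<lambda>n. measure Q {- real n + x..x}) \<longlonglongrightarrow> cdf Q x" by (simp add: cdf_def)
    from order_tendstoD(1)[OF this e]
    have "\<forall>\<^sub>F m in sequentially. e < measure Q {- real m + x..x} \<and> 0 < m"
      using eventually_gt_at_top by (rule eventually_conj)
    from eventually_happens[OF this]
    obtain m where m: "e < measure Q {- real m + x..x}" "0 < m" by auto
    have "\<forall>\<^sub>F n in sequentially. e < measure (P n) {- real m + x..x}"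
      by (rule order_tendstoD(1)[OF conv m(1)]) (use m in simp)
    then show "\<forall>\<^sub>F n in sequentially. e < cdf (P n) x"
    proof eventually_elim
      case (elim n)
      interpret P: real_distribution "P n" by fact
      have "measure (P n) {- real m + x..x} \<le> cdf (P n) x"
        unfolding cdf_def by (intro P.finite_measure_mono) auto
      then show ?case using elim by simp
    qed
  next
    fix e assume e: "cdf Q x < e"
    let ?A = "\<lambda>n. {x + 1 / (real n + 1)..x + 1 + real n + 1}"
    have "(\<lambda>n. measure Q (?A n)) \<longlonglongrightarrow> measure Q (\<Union>n. ?A n)"
    proof (intro Lim_measure_incseq)
      show "incseq ?A" unfolding incseq_def by (auto simp: field_simps)
    qed auto
    moreover have "(\<Union>n. ?A n) = {x<..}"
    proof (intro set_eqI iffI)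
      fix t assume t: "t \<in> (\<Union>n. ?A n)"
      then obtain n where "x + 1 / (real n + 1) \<le> t" by auto
      moreover have "0 < 1 / (real n + 1)" by simp
      ultimately show "t \<in> {x<..}" unfolding greaterThan_iff by linarith
    next
      fix t assume t: "t \<in> {x<..}"
      obtain n where n: "max (t - x) (1 / (t - x)) \<le> real n" using real_arch_simple by blast
      then have "1 / (t - x) \<le> real n + 1" by linarith
      then have "1 / (real n + 1) \<le> t - x" using t by (simp add: field_simps)
      moreover have "t \<le> x + 1 + real n + 1" using n by linarith
      ultimately have "t \<in> ?A n" by auto
      then show "t \<in> (\<Union>n. ?A n)" by blast
    qed
    moreover have "measure Q {x<..} = 1 - cdf Q x"
    proof -
      have "{x<..} = space Q - {..x}" by auto
      then show ?thesis using Q.prob_compl[of "{..x}"] by (simp add: cdf_def)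
    qed
    ultimately have "(\<lambda>n. measure Q (?A n)) \<longlonglongrightarrow> 1 - cdf Q x" by simp
    then have "\<forall>\<^sub>F n in sequentially. 1 - e < measure Q (?A n)"
      by (rule order_tendstoD(1)) (use e in simp)
    from eventually_happens[OF this] obtain m where m: "1 - e < measure Q (?A m)" by auto
    have less: "x + 1 / (real m + 1) < x + 1 + real m + 1"
    proof -
      have "1 / (real m + 1) \<le> 1" by simp
      then show ?thesis by linarith
    qed
    have "\<forall>\<^sub>F n in sequentially. 1 - e < measure (P n) (?A m)"
      by (rule order_tendstoD(1)[OF conv m]) (rule less)
    then show "\<forall>\<^sub>F n in sequentially. cdf (P n) x < e"
    proof eventually_elim
      case (elim n)
      interpret P: real_distribution "P n" by fact
      have "0 < 1 / (real m + 1)" by simp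
      then have "cdf (P n) x + measure (P n) (?A m) = measure (P n) ({..x} \<union> ?A m)"
        unfolding cdf_def by (intro P.finite_measure_Union[symmetric]) auto
      also have "\<dots> \<le> 1" by simp
      finally show ?case using elim by simp
    qed
  qed
qed

lemma integral_cis_full_period:
  "(LINT \<theta>:{- pi..pi}|lborel. cis (\<theta> * of_int j)) = (if j = 0 then 2 * pi else 0)"
proof -
  have int: "set_integrable lborel {- pi..pi} (\<lambda>\<theta>. cis (\<theta> * of_int j))"
    by (intro borel_integrable_atLeastAtMost' continuous_intros)
  have "((\<lambda>\<theta>. cis (\<theta> * of_int j)) has_integral (if j = 0 then 2 * pi else 0)) {- pi..pi}"
  proof (cases "j = 0")
    case True
    then show ?thesis using has_integral_const_real[of "1 :: complex" "- pi" pi]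
      by (simp add: scaleR_conv_of_real)
  next
    case False
    define F where "F \<theta> = cis (\<theta> * of_int j) / (\<i> * of_int j)" for \<theta>
    have "((\<lambda>\<theta>. cis (\<theta> * of_int j)) has_integral (F pi - F (- pi))) {- pi..pi}"
    proof (rule fundamental_theorem_of_calculus)
      fix x assume "x \<in> {- pi..pi}"
      show "(F has_vector_derivative cis (x * of_int j)) (at x within {- pi..pi})"
        unfolding F_def has_vector_derivative_def
        by (rule derivative_eq_intros HOL.refl | simp add: False scaleR_conv_of_real fun_eq_iff mult_ac)+
    qed simp
    moreover have "cis (pi * of_int j) = cis (- pi * of_int j)"
      unfolding cis_eq_iff rcong_altdef by (intro exI[of _ "- j"]) (simp add: algebra_simps)
    ultimately show ?thesis using False by (simp add: F_def)
  qed
  then show ?thesis using set_borel_integral_eq_integral(2)[OF int] by (simp add: integral_unique)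
qed

text \<open>Fourier inversion for an integer-valued random variable.\<close>
lemma (in prob_space) prob_eq_integral_cis:
  fixes Z :: "'a \<Rightarrow> int"
  assumes Z [measurable]: "Z \<in> measurable M (count_space UNIV)"
  shows "complex_of_real (prob {x \<in> space M. Z x = k}) =
    1 / (2 * pi) * (LINT \<theta>:{- pi..pi}|lborel. (LINT x|M. cis (\<theta> * of_int (Z x - k))))"
proof -
  let ?f = "\<lambda>(x, \<theta>). indicator {- pi..pi} \<theta> *\<^sub>R cis (\<theta> * of_int (Z x - k))"
  interpret P: pair_sigma_finite M lborel by standard
  have [measurable]: "cis \<in> borel_measurable borel"
    by (intro borel_measurable_continuous_onI continuous_intros)
  have meas [measurable]: "?f \<in> borel_measurable (M \<Otimes>\<^sub>M lborel)"
    by measurable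
  have "integrable (M \<Otimes>\<^sub>M lborel) ?f"
  proof (rule P.Fubini_integrable[OF meas])
    show "integrable M (\<lambda>x. \<integral>y. norm (case (x, y) of (x, \<theta>) \<Rightarrow>
        indicator {- pi..pi} \<theta> *\<^sub>R cis (\<theta> * of_int (Z x - k))) \<partial>lborel)"
      by simp
    show "AE x in M. integrable lborel (\<lambda>y. case (x, y) of (x, \<theta>) \<Rightarrow>
        indicator {- pi..pi} \<theta> *\<^sub>R cis (\<theta> * of_int (Z x - k)))"
    proof (intro AE_I2)
      fix x
      have "set_integrable lborel {- pi..pi} (\<lambda>\<theta>. cis (\<theta> * of_int (Z x - k)))"
        by (intro borel_integrable_atLeastAtMost' continuous_intros)
      then show "integrable lborel (\<lambda>y. case (x, y) of (x, \<theta>) \<Rightarrow>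
          indicator {- pi..pi} \<theta> *\<^sub>R cis (\<theta> * of_int (Z x - k)))"
        by (simp add: set_integrable_def)
    qed
  qed
  from P.Fubini_integral[OF this]
  have "(LINT \<theta>:{- pi..pi}|lborel. (LINT x|M. cis (\<theta> * of_int (Z x - k)))) =
      (LINT x|M. (LINT \<theta>:{- pi..pi}|lborel. cis (\<theta> * of_int (Z x - k))))"
    by (simp add: set_lebesgue_integral_def)
  also have "\<dots> = (LINT x|M. indicator {x \<in> space M. Z x = k} x *\<^sub>R complex_of_real (2 * pi))"
    unfolding integral_cis_full_period
    by (intro Bochner_Integration.integral_cong) (auto simp: indicator_def scaleR_conv_of_real)
  also have "\<dots> = prob {x \<in> space M. Z x = k} *\<^sub>R complex_of_real (2 * pi)"
    by (subst integral_scaleR_left) (auto simp: less_top[symmetric])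
  finally show ?thesis by (simp add: scaleR_conv_of_real)
qed

lemma integral_uniform_measure_interval:
  fixes f :: "real \<Rightarrow> complex"
  assumes T: "0 < T" and f: "f \<in> borel_measurable borel" "\<And>t. norm (f t) \<le> B"
  shows "(LINT t|uniform_measure lborel {0..T}. f t) = integral {0..T} f / of_real T"
proof -
  have set: "set_integrable lborel {0..T} f"
    unfolding set_integrable_def
    by (rule integrableI_bounded_set[where A = "{0..T}" and B = B])
      (use f T in \<open>auto simp: indicator_def intro!: AE_I2 borel_measurable_scaleR\<close>)
  have "uniform_measure lborel {0..T} = density lborel (\<lambda>t. ennreal (indicator {0..T} t / T))"
    unfolding uniform_measure_def using T
    using divide_ennreal[of 1 T] by (intro density_cong) (auto simp: indicator_def)
  then have "(LINT t|uniform_measure lborel {0..T}. f t) =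
      (LINT t|lborel. (indicator {0..T} t / T) *\<^sub>R f t)"
    using T f by (simp add: integral_density)
  also have "\<dots> = (LINT t|lborel. (1 / T) *\<^sub>R (indicator {0..T} t *\<^sub>R f t))" by simp
  also have "\<dots> = (1 / T) *\<^sub>R (LINT t:{0..T}|lborel. f t)"
    unfolding set_lebesgue_integral_def by (rule integral_scaleR_right)
  also have "\<dots> = integral {0..T} f / of_real T"
    unfolding set_borel_integral_eq_integral(2)[OF set] by (simp add: scaleR_conv_of_real divide_simps)
  finally show "(LINT t|uniform_measure lborel {0..T}. f t) = integral {0..T} f / of_real T" .
qed

text \<open>The set defined by \<open>P\<close> need not be Borel; that it is measurable at all follows from the
  completeness of Lebesgue measure.\<close>
lemma measure_lebesgue_cong_countable:
  fixes T :: real and N :: "real set"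
  assumes "countable N" and "\<And>t. t \<in> {0..T} \<Longrightarrow> t \<notin> N \<Longrightarrow> P t \<longleftrightarrow> Q t"
    and meas: "{t. Q t} \<in> sets borel"
  shows "measure lebesgue {t \<in> {0..T}. P t} = measure lborel ({0..T} \<inter> {t. Q t})"
proof -
  let ?S = "{0..T} \<inter> {t. Q t}"
  have S: "?S \<in> sets borel" using meas by (intro sets.Int) auto
  have "bounded ?S" by (rule bounded_subset[OF bounded_closed_interval, of _ 0 T]) simp
  moreover have "?S \<in> sets lebesgue" using S by simp
  ultimately have "?S \<in> lmeasurable" by (rule bounded_set_imp_lmeasurable)
  moreover have "negligible (?S - {t \<in> {0..T}. P t} \<union> ({t \<in> {0..T}. P t} - ?S))"
  proof (rule negligible_subset)
    show "negligible N"
      using countable_imp_null_set_lborel[OF assms(1)] null_sets_completionI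
      by (auto simp: negligible_iff_null_sets)
  qed (use assms(2) in auto)
  ultimately have "measure lebesgue {t \<in> {0..T}. P t} = measure lebesgue ?S"
    by (rule measure_negligible_symdiff)
  also have "\<dots> = measure lborel ?S" using S by (simp add: measure_completion)
  finally show ?thesis .
qed


lemma integrable_exp_minus_square:
  fixes \<delta> :: real
  assumes "0 < \<delta>"
  shows "integrable lborel (\<lambda>u. exp (- \<delta> * u\<^sup>2))"
proof -
  define \<tau> where "\<tau> = sqrt (1 / (2 * \<delta>))"
  have \<tau>: "0 < \<tau>" "\<tau>\<^sup>2 = 1 / (2 * \<delta>)" using assms by (auto simp: \<tau>_def)
  have "integrable lborel (\<lambda>u. sqrt (2 * pi * \<tau>\<^sup>2) * normal_density 0 \<tau> u)"
    using \<tau>(1) by simp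
  also have "(\<lambda>u. sqrt (2 * pi * \<tau>\<^sup>2) * normal_density 0 \<tau> u) = (\<lambda>u. exp (- \<delta> * u\<^sup>2))"
  proof
    fix u
    have "0 < sqrt (2 * pi * \<tau>\<^sup>2)" using \<tau>(1) by simp
    then show "sqrt (2 * pi * \<tau>\<^sup>2) * normal_density 0 \<tau> u = exp (- \<delta> * u\<^sup>2)"
      unfolding normal_density_def using \<tau> assms by (simp add: field_simps)
  qed
  finally show ?thesis .
qed

lemma measure_std_normal_interval:
  "measure std_normal_distribution {u..v} = 1 / sqrt (2 * pi) * integral {u..v} (\<lambda>x. exp (- (x\<^sup>2) / 2))"
proof -
  interpret N: real_distribution std_normal_distribution by (rule real_dist_normal_dist)
  have int: "set_integrable lborel {u..v} std_normal_density"
    unfolding set_integrable_def by (intro integrable_mult_indicator) auto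
  have "measure std_normal_distribution {u..v} = (LINT x|std_normal_distribution. indicator {u..v} x)"
    by simp
  also have "\<dots> = (LINT x:{u..v}|lborel. std_normal_density x)"
    by (subst integral_density) (auto simp: set_lebesgue_integral_def mult.commute)
  also have "\<dots> = integral {u..v} std_normal_density"
    using set_borel_integral_eq_integral(2)[OF int] .
  also have "\<dots> = 1 / sqrt (2 * pi) * integral {u..v} (\<lambda>x. exp (- (x\<^sup>2) / 2))"
    unfolding std_normal_density_def[abs_def] by (rule integral_mult_right)
  finally show ?thesis .
qed

lemma fourier_transform_gaussian:
  "(LINT u|lborel. cis (- (u * s)) * complex_of_real (exp (- u\<^sup>2 / 2))) =
     of_real (sqrt (2 * pi) * exp (- s\<^sup>2 / 2))"
proof -
  have "char std_normal_distribution (- s) =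
      (LINT u|lborel. std_normal_density u *\<^sub>R iexp (- s * u))"
    unfolding char_def by (rule integral_density) auto
  also have "\<dots> = (LINT u|lborel. of_real (1 / sqrt (2 * pi)) * (cis (- (u * s)) * complex_of_real (exp (- u\<^sup>2 / 2))))"
    by (intro Bochner_Integration.integral_cong HOL.refl)
      (simp add: std_normal_density_def scaleR_conv_of_real cis_conv_exp mult_ac)
  also have "\<dots> = of_real (1 / sqrt (2 * pi)) * (LINT u|lborel. cis (- (u * s)) * complex_of_real (exp (- u\<^sup>2 / 2)))"
    by (rule integral_mult_right_zero)
  finally show ?thesis unfolding char_std_normal_distribution by (simp add: field_simps)
qed

text \<open>The characteristic function of \<open>Z t\<close> when the time \<open>t\<close> is uniformly distributed in \<open>[0, T]\<close>.\<close>
definition time_average_cis :: "(real \<Rightarrow> int) \<Rightarrow> real \<Rightarrow> real \<Rightarrow> complex" where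
  "time_average_cis Z T \<theta> = (LINT t:{0..T}|lborel. cis (\<theta> * of_int (Z t))) / of_real T"

lemma prob_space_uniform: "0 < T \<Longrightarrow> prob_space (uniform_measure lborel {0..T :: real})"
  by (intro prob_space_uniform_measure) auto

context
  fixes Z :: "real \<Rightarrow> int" and T :: real
  assumes Z [measurable]: "Z \<in> measurable borel (count_space UNIV)" and T: "0 < T"
begin

lemma expectation_uniform_cis:
  "(LINT t|uniform_measure lborel {0..T}. cis (\<theta> * (of_int (Z t) - b))) =
     cis (- (\<theta> * b)) * time_average_cis Z T \<theta>"
proof -
  have [measurable]: "cis \<in> borel_measurable borel"
    by (intro borel_measurable_continuous_onI continuous_intros)
  have set: "set_integrable lborel {0..T} (\<lambda>t. cis (\<theta> * of_int (Z t)))"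
    unfolding set_integrable_def
    by (rule integrableI_bounded_set[where A = "{0..T}" and B = 1])
      (use T in \<open>auto simp: indicator_def intro!: AE_I2 borel_measurable_scaleR\<close>)
  have "(LINT t|uniform_measure lborel {0..T}. cis (\<theta> * (of_int (Z t) - b))) =
      (LINT t|uniform_measure lborel {0..T}. cis (- (\<theta> * b)) * cis (\<theta> * of_int (Z t)))"
    by (simp add: cis_mult algebra_simps)
  also have "\<dots> = cis (- (\<theta> * b)) * (LINT t|uniform_measure lborel {0..T}. cis (\<theta> * of_int (Z t)))"
    by (rule integral_mult_right_zero)
  also have "(LINT t|uniform_measure lborel {0..T}. cis (\<theta> * of_int (Z t))) = time_average_cis Z T \<theta>"
    using integral_uniform_measure_interval[OF T, of "\<lambda>t. cis (\<theta> * of_int (Z t))" 1]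
      set_borel_integral_eq_integral(2)[OF set] by (simp add: time_average_cis_def)
  finally show ?thesis .
qed

lemma char_normalised:
  "char (distr (uniform_measure lborel {0..T}) borel (\<lambda>t. (of_int (Z t) - b) / r)) u =
     cis (- (u / r * b)) * time_average_cis Z T (u / r)"
proof -
  have "char (distr (uniform_measure lborel {0..T}) borel (\<lambda>t. (of_int (Z t) - b) / r)) u =
      (LINT t|uniform_measure lborel {0..T}. iexp (u * ((of_int (Z t) - b) / r)))"
    unfolding char_def by (rule integral_distr) auto
  also have "\<dots> = (LINT t|uniform_measure lborel {0..T}. cis (u / r * (of_int (Z t) - b)))"
    by (simp add: cis_conv_exp)
  finally show ?thesis unfolding expectation_uniform_cis .
qed

lemma measure_normalised:
  assumes "B \<in> sets borel"
  shows "measure (distr (uniform_measure lborel {0..T}) borel (\<lambda>t. (of_int (Z t) - b) / r)) B =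
    measure lborel ({0..T} \<inter> {t. (of_int (Z t) - b) / r \<in> B}) / T"
proof -
  let ?f = "\<lambda>t. (of_int (Z t) - b) / r"
  have f [measurable]: "?f \<in> borel_measurable borel" by measurable
  have meas: "?f -` B \<in> sets borel" using measurable_sets[OF f assms] by simp
  have "measure (distr (uniform_measure lborel {0..T}) borel ?f) B =
      measure (uniform_measure lborel {0..T}) (?f -` B)"
    using assms by (subst measure_distr) auto
  also have "\<dots> = measure lborel ({0..T} \<inter> ?f -` B) / T"
    using T meas by (subst measure_uniform_measure) auto
  finally show ?thesis by (simp add: vimage_def)
qed

text \<open>Fourier inversion after the substitution \<open>\<theta> = u / r\<close>. With \<open>r = \<sigma> T\<close> the integrand converges.\<close>
lemma visit_frequency_eq_integral:
  assumes r: "0 < r"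
  shows "complex_of_real (r * (measure lborel ({0..T} \<inter> {t. Z t = k}) / T)) =
    1 / (2 * pi) * (LINT u|lborel. indicator {- pi..pi} (u / r) *\<^sub>R
      (cis (- (u / r * of_int k)) * time_average_cis Z T (u / r)))"
proof -
  let ?M = "uniform_measure lborel {0..T}"
  let ?g = "\<lambda>\<theta>. indicator {- pi..pi} \<theta> *\<^sub>R (cis (- (\<theta> * of_int k)) * time_average_cis Z T \<theta>)"
  interpret prob_space ?M by (rule prob_space_uniform[OF T])
  have "{t. Z t = k} \<in> sets borel"
    using measurable_sets[OF Z, of "{k}"] by (simp add: vimage_def)
  then have "measure lborel ({0..T} \<inter> {t. Z t = k}) / T = prob {t \<in> space ?M. Z t = k}"
    using T by (simp add: space_uniform_measure)
  also have "complex_of_real \<dots> = 1 / (2 * pi) * (LINT \<theta>|lborel. ?g \<theta>)"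
    using prob_eq_integral_cis[of Z k] expectation_uniform_cis[of _ "of_int k"] Z
    by (simp add: set_lebesgue_integral_def)
  also have "(LINT \<theta>|lborel. ?g \<theta>) = (1 / r) *\<^sub>R (LINT u|lborel. ?g (u / r))"
    using lborel_integral_real_affine[of "1 / r" ?g 0] r by simp
  finally show ?thesis using r by (simp add: scaleR_conv_of_real field_simps)
qed

end

text \<open>Levy's continuity theorem concerns sequences of probability measures; hence the passage to sequences of
  times, which are kept positive so that the uniform distribution on \<open>[0, T]\<close> exists.\<close>
lemma char_tendsto_of_clt:
  fixes Z :: "real \<Rightarrow> int" and \<sigma> a :: "real \<Rightarrow> real"
  assumes Z [measurable]: "Z \<in> measurable borel (count_space UNIV)"
    and clt: "\<And>u v. u < v \<Longrightarrow>
      ((\<lambda>T. measure lborel ({0..T} \<inter> {t. (of_int (Z t) - a T) / \<sigma> T \<in> {u..v}}) / T)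
        \<longlongrightarrow> measure std_normal_distribution {u..v}) at_top"
  shows "((\<lambda>T. cis (- (u / \<sigma> T * a T)) * time_average_cis Z T (u / \<sigma> T))
    \<longlongrightarrow> complex_of_real (exp (- u\<^sup>2 / 2))) at_top"
proof (rule tendsto_at_topI_sequentially)
  fix X :: "nat \<Rightarrow> real"
  assume X: "filterlim X at_top sequentially"
  define Y where "Y n = max 1 (X n)" for n
  have Y: "0 < Y n" for n by (simp add: Y_def)
  have XY: "\<forall>\<^sub>F n in sequentially. Y n = X n"
    using filterlim_at_top_dense[THEN iffD1, OF X, rule_format, of 1]
    by eventually_elim (simp add: Y_def)
  have "filterlim Y at_top sequentially"
    by (rule filterlim_at_top_mono[OF X]) (simp add: Y_def)
  note along_Y = filterlim_compose[OF _ this]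
  define P where "P n = distr (uniform_measure lborel {0..Y n}) borel
    (\<lambda>t. (of_int (Z t) - a (Y n)) / \<sigma> (Y n))" for n
  have "real_distribution (P n)" for n
  proof -
    interpret prob_space "uniform_measure lborel {0..Y n}" by (rule prob_space_uniform[OF Y])
    show ?thesis unfolding P_def by (intro real_distribution_distr) measurable
  qed
  moreover have "weak_conv_m P std_normal_distribution"
  proof (rule weak_conv_m_of_intervals[OF calculation real_dist_normal_dist])
    fix u v :: real
    assume "u < v"
    from along_Y[OF clt[OF this]]
    show "(\<lambda>n. measure (P n) {u..v}) \<longlonglongrightarrow> measure std_normal_distribution {u..v}"
      unfolding P_def by (subst measure_normalised[OF Z Y]) auto
  qed
  ultimately have "(\<lambda>n. char (P n) u) \<longlonglongrightarrow> char std_normal_distribution u"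
    by (intro levy_continuity1 real_dist_normal_dist)
  then have "(\<lambda>n. cis (- (u / \<sigma> (Y n) * a (Y n))) * time_average_cis Z (Y n) (u / \<sigma> (Y n)))
      \<longlonglongrightarrow> complex_of_real (exp (- u\<^sup>2 / 2))"
    unfolding P_def char_normalised[OF Z Y] char_std_normal_distribution .
  then show "(\<lambda>n. cis (- (u / \<sigma> (X n) * a (X n))) * time_average_cis Z (X n) (u / \<sigma> (X n)))
      \<longlonglongrightarrow> complex_of_real (exp (- u\<^sup>2 / 2))"
    by (rule Lim_transform_eventually) (use XY in eventually_elim, simp)
qed

text \<open>A central limit theorem with a decay estimate for the characteristic function implies a local limit
  theorem. By Fourier inversion \<open>\<sigma> T\<close> times the frequency of the visits to \<open>k T\<close> is an integral over
  \<open>\<bar>u\<bar> \<le> pi \<sigma> T\<close>. The central limit theorem yields the pointwise limit of its integrand. Domination comes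
  from the decay: since \<open>(\<sigma> T)\<^sup>2 \<le> C ln T\<close>, the bound \<open>T powr (- \<epsilon> (u / \<sigma> T)\<^sup>2)\<close> is at most
  \<open>exp (- (\<epsilon> / C) u\<^sup>2)\<close>.\<close>
lemma temporal_local_limit:
  fixes Z k :: "real \<Rightarrow> int" and \<sigma> a :: "real \<Rightarrow> real"
  assumes Z [measurable]: "Z \<in> measurable borel (count_space UNIV)"
    and clt: "\<And>u v. u < v \<Longrightarrow>
      ((\<lambda>T. measure lborel ({0..T} \<inter> {t. (of_int (Z t) - a T) / \<sigma> T \<in> {u..v}}) / T)
        \<longlongrightarrow> measure std_normal_distribution {u..v}) at_top"
    and \<sigma>: "\<And>T. 0 < T \<Longrightarrow> 0 < \<sigma> T" "filterlim \<sigma> at_top at_top"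
      "0 < C" "\<forall>\<^sub>F T in at_top. (\<sigma> T)\<^sup>2 \<le> C * ln T"
    and decay: "0 < \<epsilon>" "\<forall>\<^sub>F T in at_top. \<forall>\<theta>. \<bar>\<theta>\<bar> \<le> pi \<longrightarrow>
      norm (time_average_cis Z T \<theta>) \<le> K * T powr (- \<epsilon> * \<theta>\<^sup>2)"
    and k: "((\<lambda>T. (of_int (k T) - a T) / \<sigma> T) \<longlongrightarrow> s) at_top"
  shows "((\<lambda>T. \<sigma> T * (measure lborel ({0..T} \<inter> {t. Z t = k T}) / T))
    \<longlongrightarrow> exp (- s\<^sup>2 / 2) / sqrt (2 * pi)) at_top"
proof -
  define F where "F T u = indicator {- pi..pi} (u / \<sigma> T) *\<^sub>R
    (cis (- (u / \<sigma> T * of_int (k T))) * time_average_cis Z T (u / \<sigma> T))" for T u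
  define G where "G u = cis (- (u * s)) * complex_of_real (exp (- u\<^sup>2 / 2))" for u
  have cis_meas [measurable]: "cis \<in> borel_measurable borel"
    by (intro borel_measurable_continuous_onI continuous_intros)
  have "((\<lambda>T. LINT u|lborel. F T u) \<longlongrightarrow> (LINT u|lborel. G u)) at_top"
  proof (rule integral_dominated_convergence_at_top)
    show "G \<in> borel_measurable lborel" unfolding G_def by measurable
    show "F T \<in> borel_measurable lborel" for T
      unfolding F_def time_average_cis_def set_lebesgue_integral_def by measurable
    show "integrable lborel (\<lambda>u. \<bar>K\<bar> * exp (- (\<epsilon> / C) * u\<^sup>2))"
      using decay(1) \<sigma>(3) by (intro integrable_mult_right integrable_exp_minus_square) simp
    show "AE u in lborel. ((\<lambda>T. F T u) \<longlongrightarrow> G u) at_top"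
    proof (intro AE_I2)
      fix u :: real
      have 1: "((\<lambda>T. cis (- (u * ((of_int (k T) - a T) / \<sigma> T)))) \<longlongrightarrow> cis (- (u * s))) at_top"
        using k by (intro tendsto_intros)
      have "((\<lambda>T. cis (- (u * ((of_int (k T) - a T) / \<sigma> T))) *
          (cis (- (u / \<sigma> T * a T)) * time_average_cis Z T (u / \<sigma> T))) \<longlongrightarrow> G u) at_top"
        unfolding G_def by (intro tendsto_mult[OF 1] char_tendsto_of_clt Z clt)
      moreover have "\<forall>\<^sub>F T in at_top. cis (- (u * ((of_int (k T) - a T) / \<sigma> T))) *
          (cis (- (u / \<sigma> T * a T)) * time_average_cis Z T (u / \<sigma> T)) = F T u"
        using filterlim_at_top_dense[THEN iffD1, OF \<sigma>(2), rule_format, of "\<bar>u\<bar> / pi"]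
          eventually_gt_at_top[of 0]
      proof eventually_elim
        case (elim T)
        then have "\<bar>u\<bar> \<le> pi * \<sigma> T" by (simp add: field_simps)
        then have "u / \<sigma> T \<in> {- pi..pi}" using \<sigma>(1)[OF elim(2)] by (auto simp: field_simps abs_le_iff)
        then show ?case
          unfolding F_def mult.assoc[symmetric] cis_mult
          by (simp add: diff_divide_distrib algebra_simps)
      qed
      ultimately show "((\<lambda>T. F T u) \<longlongrightarrow> G u) at_top" by (rule Lim_transform_eventually)
    qed
    show "\<forall>\<^sub>F T in at_top. AE u in lborel. norm (F T u) \<le> \<bar>K\<bar> * exp (- (\<epsilon> / C) * u\<^sup>2)"
      using decay(2) \<sigma>(4) eventually_gt_at_top[of 1]
    proof eventually_elim
      case (elim T)
      have sT: "0 < \<sigma> T" using \<sigma>(1) elim by simp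
      show ?case
      proof (intro AE_I2)
        fix u :: real
        show "norm (F T u) \<le> \<bar>K\<bar> * exp (- (\<epsilon> / C) * u\<^sup>2)"
        proof (cases "\<bar>u / \<sigma> T\<bar> \<le> pi")
          case False
          then have "F T u = 0" by (auto simp: F_def indicator_def abs_le_iff)
          then show ?thesis by simp
        next
          case True
          have "u\<^sup>2 / C \<le> (u / \<sigma> T)\<^sup>2 * ln T"
          proof -
            have "u\<^sup>2 * (\<sigma> T)\<^sup>2 \<le> u\<^sup>2 * (C * ln T)" using elim(2) by (intro mult_left_mono) auto
            then show ?thesis using \<sigma>(3) sT by (simp add: field_simps)
          qed
          then have exponent: "- \<epsilon> * (u / \<sigma> T)\<^sup>2 * ln T \<le> - (\<epsilon> / C) * u\<^sup>2"
            using decay(1) mult_left_mono[of "u\<^sup>2 / C" "(u / \<sigma> T)\<^sup>2 * ln T" \<epsilon>] by simp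
          have "norm (F T u) \<le> norm (time_average_cis Z T (u / \<sigma> T))"
            by (simp add: F_def norm_mult indicator_def)
          also have "\<dots> \<le> K * T powr (- \<epsilon> * (u / \<sigma> T)\<^sup>2)" using elim(1) True by blast
          also have "\<dots> \<le> \<bar>K\<bar> * T powr (- \<epsilon> * (u / \<sigma> T)\<^sup>2)" by (intro mult_right_mono) auto
          also have "\<dots> = \<bar>K\<bar> * exp (- \<epsilon> * (u / \<sigma> T)\<^sup>2 * ln T)"
            using elim(3) by (simp add: powr_def)
          also have "\<dots> \<le> \<bar>K\<bar> * exp (- (\<epsilon> / C) * u\<^sup>2)"
            using exponent by (intro mult_left_mono) auto
          finally show ?thesis .
        qed
      qed
    qed
  qed
  then have "((\<lambda>T. 1 / (2 * pi) * (LINT u|lborel. F T u)) \<longlongrightarrow>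
      1 / (2 * pi) * complex_of_real (sqrt (2 * pi) * exp (- s\<^sup>2 / 2))) at_top"
    unfolding G_def fourier_transform_gaussian by (rule tendsto_mult_left)
  moreover have "\<forall>\<^sub>F T in at_top. 1 / (2 * pi) * (LINT u|lborel. F T u) =
      complex_of_real (\<sigma> T * (measure lborel ({0..T} \<inter> {t. Z t = k T}) / T))"
    using eventually_gt_at_top[of 0]
  proof eventually_elim
    case (elim T)
    then show ?case
      unfolding F_def using visit_frequency_eq_integral[OF Z elim \<sigma>(1)[OF elim], of "k T"] by simp
  qed
  ultimately have "((\<lambda>T. complex_of_real (\<sigma> T * (measure lborel ({0..T} \<inter> {t. Z t = k T}) / T))) \<longlongrightarrow>
      1 / (2 * pi) * complex_of_real (sqrt (2 * pi) * exp (- s\<^sup>2 / 2))) at_top"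
    by (rule Lim_transform_eventually)
  also have "1 / (2 * pi) * complex_of_real (sqrt (2 * pi) * exp (- s\<^sup>2 / 2)) =
      complex_of_real (exp (- s\<^sup>2 / 2) / sqrt (2 * pi))"
  proof -
    have "1 / (2 * pi) * (sqrt (2 * pi) * exp (- s\<^sup>2 / 2)) = exp (- s\<^sup>2 / 2) / sqrt (2 * pi)"
      using real_sqrt_mult_self[of "2 * pi"] by (simp add: field_simps del: real_sqrt_mult)
    then show ?thesis by (metis of_real_1 of_real_divide of_real_mult)
  qed
  finally show ?thesis by (simp only: tendsto_of_real_iff)
qed

section \<open>The temporal local limit theorem for the staircase\<close>

lemma itinerary_measurable [measurable]: "itinerary h k0 K \<in> measurable borel (count_space UNIV)"
proof -
  have [measurable]: "K \<in> measurable (count_space UNIV) (count_space UNIV)" by simp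
  show ?thesis unfolding itinerary_def by measurable
qed

lemma has_integral_itinerary:
  assumes "0 \<le> h"
  shows "((\<lambda>t. cis (\<theta> * of_int (itinerary h k0 K t))) has_integral
    of_real h * cis (\<theta> * of_int k0) + (\<Sum>i<n. cis (\<theta> * of_int (K i)))) {0..h + real n}"
proof (induction n)
  case 0
  have "((\<lambda>t. cis (\<theta> * of_int k0)) has_integral of_real h * cis (\<theta> * of_int k0)) {0..h}"
    using has_integral_const_real[of "cis (\<theta> * of_int k0)" 0 h] assms
    by (simp add: scaleR_conv_of_real)
  then have "((\<lambda>t. cis (\<theta> * of_int (itinerary h k0 K t))) has_integral of_real h * cis (\<theta> * of_int k0)) {0..h}"
    by (rule has_integral_spike_finite[of "{h}", rotated 2]) (auto simp: itinerary_def)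
  then show ?case by simp
next
  case (Suc n)
  have "((\<lambda>t. cis (\<theta> * of_int (K n))) has_integral cis (\<theta> * of_int (K n))) {h + real n..h + real (Suc n)}"
    using has_integral_const_real[of "cis (\<theta> * of_int (K n))" "h + real n" "h + real (Suc n)"] by simp
  then have "((\<lambda>t. cis (\<theta> * of_int (itinerary h k0 K t))) has_integral cis (\<theta> * of_int (K n)))
      {h + real n..h + real (Suc n)}"
  proof (rule has_integral_spike_finite[of "{h + real (Suc n)}", rotated 2])
    fix t assume t: "t \<in> {h + real n..h + real (Suc n)} - {h + real (Suc n)}"
    then have "\<lfloor>t - h\<rfloor> = int n" by (intro floor_unique) auto
    then show "cis (\<theta> * of_int (itinerary h k0 K t)) = cis (\<theta> * of_int (K n))"
      using t by (simp add: itinerary_def)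
  qed simp
  from has_integral_combine[OF _ _ Suc this] assms show ?case by (simp add: add.assoc)
qed

lemma norm_time_average_itinerary_le:
  assumes h: "0 \<le> h" "h \<le> 1" and T: "1 \<le> T"
  shows "norm (time_average_cis (itinerary h k0 K) T \<theta>) \<le>
    (2 + norm (\<Sum>i<nat \<lfloor>T - h\<rfloor>. cis (\<theta> * of_int (K i)))) / T"
proof -
  define g where "g t = cis (\<theta> * of_int (itinerary h k0 K t))" for t
  define n where "n = nat \<lfloor>T - h\<rfloor>"
  have n: "h + real n \<le> T" "T \<le> h + real n + 1" using h T unfolding n_def by linarith+
  have cis_meas [measurable]: "cis \<in> borel_measurable borel"
    by (intro borel_measurable_continuous_onI continuous_intros)
  have meas: "g \<in> borel_measurable borel" unfolding g_def by measurable
  have set: "set_integrable lborel {0..T} g"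
    unfolding set_integrable_def
    by (rule integrableI_bounded_set[where A = "{0..T}" and B = 1])
      (use T meas in \<open>auto simp: g_def indicator_def intro!: AE_I2 borel_measurable_scaleR\<close>)
  note int = set_borel_integral_eq_integral(1)[OF set]
  have rest: "g integrable_on {h + real n..T}"
    by (rule integrable_subinterval_real[OF int]) (use h in auto)
  have first: "integral {0..h + real n} g = of_real h * cis (\<theta> * of_int k0) + (\<Sum>i<n. cis (\<theta> * of_int (K i)))"
    unfolding g_def by (rule integral_unique[OF has_integral_itinerary[OF h(1)]])
  have "integral {0..T} g = integral {0..h + real n} g + integral {h + real n..T} g"
    using h n int by (intro Henstock_Kurzweil_Integration.integral_combine[symmetric]) auto
  then have "norm (integral {0..T} g) \<le> norm (integral {0..h + real n} g) + norm (integral {h + real n..T} g)"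
    by (simp add: norm_triangle_ineq)
  also have "norm (integral {h + real n..T} g) \<le> 1 * measure lborel {h + real n..T}"
    by (rule has_integral_bound_real[OF _ finite.emptyI integrable_integral[OF rest]]) (auto simp: g_def)
  also have "norm (integral {0..h + real n} g) \<le> 1 + norm (\<Sum>i<n. cis (\<theta> * of_int (K i)))"
    unfolding first by (rule order.trans[OF norm_triangle_ineq]) (use h in \<open>simp add: norm_mult\<close>)
  finally have "norm (integral {0..T} g) \<le> 2 + norm (\<Sum>i<n. cis (\<theta> * of_int (K i)))"
    using n by simp
  then show ?thesis
    using T set_borel_integral_eq_integral(2)[OF set]
    by (simp add: time_average_cis_def norm_divide divide_right_mono n_def g_def)
qed

text \<open>The part of the itinerary before the walk sets in has a fixed length, which does no harm because
  \<open>T powr (1 - \<epsilon> \<theta>\<^sup>2) \<ge> 1\<close>.\<close>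
lemma walk_itinerary_decay:
  assumes bad: "badly_approximable c \<alpha>" and h: "0 \<le> h" "h \<le> 1"
    and K: "\<And>n. K (N + n) = K N + walk (2 * \<alpha>) X n"
  obtains \<epsilon> B where "0 < \<epsilon>" "\<forall>T\<ge>1. \<forall>\<theta>. \<bar>\<theta>\<bar> \<le> pi \<longrightarrow>
    norm (time_average_cis (itinerary h k0 K) T \<theta>) \<le> B * T powr (- \<epsilon> * \<theta>\<^sup>2)"
proof -
  obtain A \<epsilon> where A: "0 < A" "0 < \<epsilon>" "\<epsilon> * pi\<^sup>2 \<le> 1" and
    decay: "\<And>\<theta> x L. \<bar>\<theta>\<bar> \<le> pi \<Longrightarrow>
      norm (walk_exp_sum (2 * \<alpha>) \<theta> x L) \<le> A * real L powr (1 - \<epsilon> * \<theta>\<^sup>2)"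
    using walk_exp_sum_decay[OF bad] by metis
  have "norm (time_average_cis (itinerary h k0 K) T \<theta>) \<le> (2 + real N + A) * T powr (- \<epsilon> * \<theta>\<^sup>2)"
    if T: "1 \<le> T" and \<theta>: "\<bar>\<theta>\<bar> \<le> pi" for T \<theta>
  proof -
    define p where "p = 1 - \<epsilon> * \<theta>\<^sup>2"
    have "\<theta>\<^sup>2 \<le> pi\<^sup>2" using \<theta> by (metis abs_le_square_iff abs_of_pos pi_gt_zero)
    then have "\<epsilon> * \<theta>\<^sup>2 \<le> 1" using A mult_left_mono[of "\<theta>\<^sup>2" "pi\<^sup>2" \<epsilon>] by linarith
    then have p: "0 \<le> p" by (simp add: p_def)
    define n where "n = nat \<lfloor>T - h\<rfloor>"
    have n: "real n \<le> T" using h T unfolding n_def by linarith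
    have one: "1 \<le> T powr p" using T p by (intro ge_one_powr_ge_zero) auto
    let ?S = "\<lambda>I. \<Sum>i\<in>I. cis (\<theta> * of_int (K i))"
    have head: "norm (?S {..<m}) \<le> real m" for m
      using norm_sum[of "\<lambda>i. cis (\<theta> * of_int (K i))" "{..<m}"] by simp
    have "norm (?S {..<n}) \<le> real N + A * T powr p"
    proof (cases "n \<le> N")
      case True
      have "0 \<le> A * T powr p" using A by simp
      then show ?thesis using head[of n] True by linarith
    next
      case False
      have "?S {..<n} = ?S {..<N} + ?S {N..<n}"
        using False by (simp add: lessThan_atLeast0 sum.atLeastLessThan_concat)
      also have "?S {N..<n} = (\<Sum>i<n - N. cis (\<theta> * of_int (K (N + i))))"
        using False sum.shift_bounds_nat_ivl[of "\<lambda>i. cis (\<theta> * of_int (K i))" 0 N "n - N"]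
        by (simp add: lessThan_atLeast0 add.commute)
      also have "\<dots> = cis (\<theta> * of_int (K N)) * walk_exp_sum (2 * \<alpha>) \<theta> X (n - N)"
        unfolding walk_exp_sum_def K by (simp add: sum_distrib_left cis_mult distrib_left)
      finally have "norm (?S {..<n}) \<le> norm (?S {..<N}) + norm (walk_exp_sum (2 * \<alpha>) \<theta> X (n - N))"
        by (metis norm_triangle_ineq norm_mult norm_cis mult_1)
      also have "\<dots> \<le> real N + A * real (n - N) powr p"
        using decay[OF \<theta>, of X "n - N"] head[of N] by (simp add: p_def)
      also have "\<dots> \<le> real N + A * T powr p"
        using n p A by (intro add_left_mono mult_left_mono powr_mono2) auto
      finally show ?thesis .
    qed
    then have "2 + norm (?S {..<n}) \<le> (2 + real N) * 1 + A * T powr p" by simp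
    also have "\<dots> \<le> (2 + real N) * T powr p + A * T powr p"
      by (intro add_right_mono mult_left_mono one) simp
    finally have "2 + norm (?S {..<n}) \<le> (2 + real N) * T powr p + A * T powr p" .
    then have "(2 + norm (?S {..<n})) / T \<le> ((2 + real N + A) * T powr p) / T"
      using T by (intro divide_right_mono) (auto simp: algebra_simps)
    also have "\<dots> = (2 + real N + A) * T powr (- \<epsilon> * \<theta>\<^sup>2)"
      using T powr_diff[of T p 1] by (simp add: p_def)
    finally show ?thesis
      using norm_time_average_itinerary_le[OF h T, of k0 K \<theta>] unfolding n_def by (rule order.trans[rotated])
  qed
  then show ?thesis using that[OF A(2)] by blast
qed

theorem theorem1p36:
  fixes \<alpha> \<beta> :: real
    and \<sigma> :: "real \<Rightarrow> real"
    and a :: "real \<Rightarrow> stair \<Rightarrow> real"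
    and \<omega> :: stair
    and k :: "real \<Rightarrow> int"
    and s :: real
  assumes "0 < \<alpha>" "\<alpha> < 1" "\<alpha> \<notin> \<rat>" "bounded_type \<alpha>"
    and "\<beta> = 2 * \<alpha> - 1"
    and "\<forall>T>0. \<sigma> T > 0"
    and "\<forall>\<omega> u v. u < v \<longrightarrow>
      ((\<lambda>T. 1 / T * measure lebesgue
          {t \<in> {0..T}. (real_of_int (level (stair_flow \<beta> t \<omega>)) - a T \<omega>) / \<sigma> T \<in> {u..v}})
        \<longlongrightarrow> 1 / sqrt (2 * pi) * integral {u..v} (\<lambda>x. exp (- (x\<^sup>2) / 2))) at_top"
    and "\<exists>C>0. \<forall>\<omega>. \<forall>T>C. \<bar>a T \<omega>\<bar> \<le> C * ln T \<and>
      inverse C \<le> \<sigma> T / sqrt (ln T) \<and> \<sigma> T / sqrt (ln T) \<le> C"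
    and "\<exists>C>0. \<forall>\<omega>. \<forall>T>C. \<exists>n::nat. inverse C < real n / ln T \<and> real n / ln T < C \<and>
      a T \<omega> = real_of_int (renorm_level \<beta> n \<omega>)"
    and "((\<lambda>T. (real_of_int (k T) - a T \<omega>) / \<sigma> T) \<longlongrightarrow> s) at_top"
  shows "(\<lambda>T. 1 / T * measure lebesgue {t \<in> {0..T}. stair_flow \<beta> t \<omega> \<in> horizontal_rect (k T)})
    \<sim>[at_top] (\<lambda>T. exp (- (s\<^sup>2) / 2) / sqrt (2 * pi * (\<sigma> T)\<^sup>2))"
proof -
  obtain c where bad: "badly_approximable c \<alpha>"
    using bounded_type_imp_badly_approximable assms(3,4) by blast
  have "\<beta> \<notin> \<rat>"
  proof
    assume "\<beta> \<in> \<rat>"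
    then have "(\<beta> + 1) / 2 \<in> \<rat>" by (intro Rats_divide Rats_add) auto
    then show False using assms(3,5) by simp
  qed
  obtain h k0 N X and K :: "nat \<Rightarrow> int" where h: "0 < h" "h \<le> 1"
    and loc: "\<And>t j. 0 < t \<Longrightarrow> t - h \<notin> \<int> \<Longrightarrow>
       level (stair_flow \<beta> t \<omega>) = itinerary h k0 K t \<and>
       (stair_flow \<beta> t \<omega> \<in> horizontal_rect j \<longleftrightarrow> itinerary h k0 K t = j)"
    and K\<beta>: "\<And>n. K (N + n) = K N + walk (\<beta> + 1) X n"
    by (rule flow_follows_walk[OF \<open>\<beta> \<notin> \<rat>\<close>, of \<omega>]) (rule that)
  have K: "K (N + n) = K N + walk (2 * \<alpha>) X n" for n
    using K\<beta>[of n] assms(5) by simp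
  define Z where "Z = itinerary h k0 K"
  \<comment> \<open>the instants at which the trajectory may be on an edge of a rectangle\<close>
  define E where "E = insert 0 ((\<lambda>j. h + of_int j) ` UNIV)"
  have E: "countable E" by (simp add: E_def)
  have off_E: "0 < t \<and> t - h \<notin> \<int>" if "t \<in> {0..T}" "t \<notin> E" for t T
  proof -
    have "t \<noteq> 0" using that(2) by (auto simp: E_def)
    moreover have "t - h \<notin> \<int>"
    proof
      assume "t - h \<in> \<int>"
      then obtain j where "t - h = of_int j" by (auto elim: Ints_cases)
      then have "t = h + of_int j" by simp
      then show False using that(2) by (auto simp: E_def)
    qed
    ultimately show ?thesis using that(1) by auto
  qed
  have Z_meas [measurable]: "Z \<in> measurable borel (count_space UNIV)" by (simp add: Z_def)
  have measure_rect: "measure lebesgue {t \<in> {0..T}. stair_flow \<beta> t \<omega> \<in> horizontal_rect j} =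
      measure lborel ({0..T} \<inter> {t. Z t = j})" for T j
  proof (rule measure_lebesgue_cong_countable[OF E])
    show "{t. Z t = j} \<in> sets borel"
      using measurable_sets[OF Z_meas, of "{j}"] by (simp add: vimage_def)
  qed (use off_E loc in \<open>auto simp: Z_def\<close>)
  have measure_level: "measure lebesgue {t \<in> {0..T}. (real_of_int (level (stair_flow \<beta> t \<omega>)) - b) / r \<in> {u..v}} =
      measure lborel ({0..T} \<inter> {t. (of_int (Z t) - b) / r \<in> {u..v}})" for T b r u v
  proof (rule measure_lebesgue_cong_countable[OF E])
    show "{t. (of_int (Z t) - b) / r \<in> {u..v}} \<in> sets borel" by measurable
  qed (use off_E loc in \<open>auto simp: Z_def\<close>)
  obtain C where C: "0 < C" "\<And>T. C < T \<Longrightarrow> inverse C \<le> \<sigma> T / sqrt (ln T) \<and> \<sigma> T / sqrt (ln T) \<le> C"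
    using assms(8) by blast
  have \<sigma>_bounds: "\<forall>\<^sub>F T in at_top. inverse C * sqrt (ln T) \<le> \<sigma> T \<and> (\<sigma> T)\<^sup>2 \<le> C\<^sup>2 * ln T"
    using eventually_gt_at_top[of C] eventually_gt_at_top[of 1]
  proof eventually_elim
    case (elim T)
    have ln: "0 < sqrt (ln T)" using elim by simp
    have low: "inverse C * sqrt (ln T) \<le> \<sigma> T" and up: "\<sigma> T \<le> C * sqrt (ln T)"
      using C(2)[OF elim(1)] ln by (simp_all add: pos_le_divide_eq pos_divide_le_eq)
    have "0 \<le> \<sigma> T" using assms(6) elim by (simp add: less_imp_le)
    then have "(\<sigma> T)\<^sup>2 \<le> (C * sqrt (ln T))\<^sup>2" using up by (intro power_mono)
    then show ?case using low elim by (simp add: power_mult_distrib)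
  qed
  have "filterlim (\<lambda>T. inverse C * sqrt (ln T)) at_top at_top"
    using C(1) by (intro filterlim_tendsto_pos_mult_at_top[OF tendsto_const]
      filterlim_compose[OF sqrt_at_top ln_at_top]) simp
  then have \<sigma>_top: "filterlim \<sigma> at_top at_top"
    by (rule filterlim_at_top_mono) (use \<sigma>_bounds in eventually_elim, simp)
  obtain \<epsilon> B where \<epsilon>: "0 < \<epsilon>" "\<forall>T\<ge>1. \<forall>\<theta>. \<bar>\<theta>\<bar> \<le> pi \<longrightarrow>
      norm (time_average_cis Z T \<theta>) \<le> B * T powr (- \<epsilon> * \<theta>\<^sup>2)"
    using walk_itinerary_decay[OF bad less_imp_le[OF h(1)] h(2) K, of k0] unfolding Z_def by blast
  have limit: "((\<lambda>T. \<sigma> T * (measure lborel ({0..T} \<inter> {t. Z t = k T}) / T))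
    \<longlongrightarrow> exp (- s\<^sup>2 / 2) / sqrt (2 * pi)) at_top"
  proof (rule temporal_local_limit[OF Z_meas, where a = "\<lambda>T. a T \<omega>"])
    fix u v :: real
    assume "u < v"
    then show "((\<lambda>T. measure lborel ({0..T} \<inter> {t. (of_int (Z t) - a T \<omega>) / \<sigma> T \<in> {u..v}}) / T)
        \<longlongrightarrow> measure std_normal_distribution {u..v}) at_top"
      using assms(7) unfolding measure_level[symmetric] measure_std_normal_interval by simp
  next
    show "0 < \<sigma> T" if "0 < T" for T using assms(6) that by blast
    show "filterlim \<sigma> at_top at_top" by (rule \<sigma>_top)
    show "0 < C\<^sup>2" using C(1) by simp
    show "\<forall>\<^sub>F T in at_top. (\<sigma> T)\<^sup>2 \<le> C\<^sup>2 * ln T" using \<sigma>_bounds by eventually_elim simp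
    show "0 < \<epsilon>" by (rule \<epsilon>(1))
    show "\<forall>\<^sub>F T in at_top. \<forall>\<theta>. \<bar>\<theta>\<bar> \<le> pi \<longrightarrow> norm (time_average_cis Z T \<theta>) \<le> B * T powr (- \<epsilon> * \<theta>\<^sup>2)"
      by (rule eventually_mono[OF eventually_ge_at_top[of 1]]) (use \<epsilon>(2) in blast)
    show "((\<lambda>T. (of_int (k T) - a T \<omega>) / \<sigma> T) \<longlongrightarrow> s) at_top" by (rule assms(10))
  qed
  show ?thesis
  proof (rule asymp_equivI')
    define d where "d = exp (- s\<^sup>2 / 2) / sqrt (2 * pi)"
    have d: "0 < d" by (simp add: d_def)
    have "((\<lambda>T. \<sigma> T * (measure lborel ({0..T} \<inter> {t. Z t = k T}) / T) / d) \<longlongrightarrow> d / d) at_top"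
      using limit d unfolding d_def[symmetric] by (intro tendsto_intros) auto
    moreover have "\<forall>\<^sub>F T in at_top. \<sigma> T * (measure lborel ({0..T} \<inter> {t. Z t = k T}) / T) / d =
        1 / T * measure lebesgue {t \<in> {0..T}. stair_flow \<beta> t \<omega> \<in> horizontal_rect (k T)} /
          (exp (- (s\<^sup>2) / 2) / sqrt (2 * pi * (\<sigma> T)\<^sup>2))"
      using eventually_gt_at_top[of 0]
    proof eventually_elim
      case (elim T)
      then have "0 < \<sigma> T" using assms(6) by blast
      then show ?case unfolding measure_rect d_def by (simp add: real_sqrt_mult)
    qed
    ultimately show "((\<lambda>T. 1 / T * measure lebesgue {t \<in> {0..T}. stair_flow \<beta> t \<omega> \<in> horizontal_rect (k T)} /
        (exp (- (s\<^sup>2) / 2) / sqrt (2 * pi * (\<sigma> T)\<^sup>2))) \<longlongrightarrow> 1) at_top"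
      using d by (simp add: Lim_transform_eventually)
  qed
qed

end
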